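(* Let $\Omega\subset\mathbb C^n$ be a bounded pseudoconvex domain with $C^2$ boundary, and let $d(z)$ denote the Euclidean distance from $z$ to $\partial\Omega$. Suppose that there exist a $C^2$ plurisubharmonic function $\lambda$ on $\Omega$ with $0\le\lambda\le1$, a number $\alpha>1$ and a constant $c>0$ such that $$i\partial\bar\partial\lambda\ \ge\ c\,|\log d|^{\alpha}\ i\partial\bar\partial|z|^2\qquad\text{on }\Omega.$$ Then $\Omega$ is delta-regular.
   Context: A $C^2$ defining function of a bounded domain $\Omega\subset\mathbb C^n$ is a real-valued $C^2$ function $\rho$ on a neighborhood of $\overline\Omega$ with $\Omega=\{\rho<0\}$ and $d\rho\neq0$ on $\partial\Omega$. A bounded domain $\Omega\subset\mathbb C^n$ is called delta-regular if there exist a bounded $C^2$ plurisubharmonic function $\tilde\lambda$ on $\Omega$ and a $C^2$ defining function $\rho$ of $\Omega$ such that $i\partial\bar\partial\tilde\lambda\ge\rho^{-1}\,i\partial\bar\partial\rho$ on $\Omega$ (inequality of real $(1,1)$-forms). *)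

theory Defs
  imports "HOL-Analysis.Analysis"
begin

definition C2_on :: "'a::real_normed_vector set \<Rightarrow> ('a \<Rightarrow> real) \<Rightarrow> bool" where
  "C2_on U u \<longleftrightarrow>
    (\<exists>(u' :: 'a \<Rightarrow> 'a \<Rightarrow>\<^sub>L real) (u'' :: 'a \<Rightarrow> 'a \<Rightarrow>\<^sub>L ('a \<Rightarrow>\<^sub>L real)).
      (\<forall>z\<in>U. (u has_derivative blinfun_apply (u' z)) (at z)) \<and>
      (\<forall>z\<in>U. (u' has_derivative blinfun_apply (u'' z)) (at z)) \<and>
      continuous_on U u'')"

text \<open>
  The Wirtinger derivatives: with coordinates z_j = x_j + i y_j, the partial derivatives in x_j and
  y_j are the real directional derivatives along axis j 1 and axis j i.
\<close>

definition dz :: "'n \<Rightarrow> (complex^'n \<Rightarrow> complex) \<Rightarrow> complex^'n \<Rightarrow> complex" where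
  "dz j f z = (frechet_derivative f (at z) (axis j 1)
               - \<i> * frechet_derivative f (at z) (axis j \<i>)) / 2"

definition dzbar :: "'n \<Rightarrow> (complex^'n \<Rightarrow> complex) \<Rightarrow> complex^'n \<Rightarrow> complex" where
  "dzbar j f z = (frechet_derivative f (at z) (axis j 1)
                  + \<i> * frechet_derivative f (at z) (axis j \<i>)) / 2"

text \<open>
  A real (1,1)-form i sum_{j,k} A_{jk} dz_j wedge d(conj z_k) is represented by its coefficient
  matrix A, which is Hermitian. In this representation, ddbar u z is the form i (d d-bar u) at z.
\<close>

definition ddbar :: "(complex^'n \<Rightarrow> real) \<Rightarrow> complex^'n \<Rightarrow> complex^'n^'n" where
  "ddbar u z = (\<chi> j k. dz j (dzbar k (\<lambda>w. complex_of_real (u w))) z)"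

text \<open>
  Taking the real part changes nothing for a Hermitian matrix, in particular for ddbar u z at a
  point near which u is twice continuously differentiable.
\<close>

definition form_val :: "complex^'n^'n \<Rightarrow> complex^'n \<Rightarrow> real" where
  "form_val A \<xi> = Re (\<Sum>j\<in>UNIV. \<Sum>k\<in>UNIV. A $ j $ k * \<xi> $ j * cnj (\<xi> $ k))"

definition form_le :: "complex^'n^'n \<Rightarrow> complex^'n^'n \<Rightarrow> bool" where
  "form_le A B \<longleftrightarrow> (\<forall>\<xi>. form_val A \<xi> \<le> form_val B \<xi>)"

text \<open>
  Plurisubharmonicity of a function that does not take the value minus infinity: upper
  semicontinuity and the sub-mean value property on every closed complex affine disc. A
  plurisubharmonic function with finite values is integrable on circles; demanding this explicitly
  rules out the default value of a nonexistent integral.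
\<close>

definition psh_on :: "(complex^'n) set \<Rightarrow> (complex^'n \<Rightarrow> real) \<Rightarrow> bool" where
  "psh_on S u \<longleftrightarrow>
    (\<forall>c. openin (top_of_set S) {z\<in>S. u z < c}) \<and>
    (\<forall>a b. (\<forall>\<zeta>\<in>cball 0 1. a + \<zeta> *s b \<in> S) \<longrightarrow>
       (\<lambda>t. u (a + cis t *s b)) integrable_on {0..2 * pi} \<and>
       u a \<le> integral {0..2 * pi} (\<lambda>t. u (a + cis t *s b)) / (2 * pi))"

definition bounded_domain :: "(complex^'n) set \<Rightarrow> bool" where
  "bounded_domain \<Omega> \<longleftrightarrow> open \<Omega> \<and> connected \<Omega> \<and> \<Omega> \<noteq> {} \<and> bounded \<Omega>"

definition C2_defining_function :: "(complex^'n) set \<Rightarrow> (complex^'n \<Rightarrow> real) \<Rightarrow> bool" where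
  "C2_defining_function \<Omega> \<rho> \<longleftrightarrow>
    (\<exists>U. open U \<and> closure \<Omega> \<subseteq> U \<and> C2_on U \<rho> \<and> \<Omega> = {z\<in>U. \<rho> z < 0}) \<and>
    (\<forall>p\<in>frontier \<Omega>. frechet_derivative \<rho> (at p) \<noteq> (\<lambda>v. 0))"

definition C2_boundary :: "(complex^'n) set \<Rightarrow> bool" where
  "C2_boundary \<Omega> \<longleftrightarrow> (\<exists>\<rho>. C2_defining_function \<Omega> \<rho>)"

text \<open>
  Pseudoconvexity of a domain with twice continuously differentiable boundary (Levi): the Levi form
  of a defining function is nonnegative on the complex tangent space at every boundary point. The
  condition does not depend on the defining function, so asking for one of them suffices.
\<close>

definition pseudoconvex :: "(complex^'n) set \<Rightarrow> bool" where
  "pseudoconvex \<Omega> \<longleftrightarrow>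
    (\<exists>\<rho>. C2_defining_function \<Omega> \<rho> \<and>
      (\<forall>p\<in>frontier \<Omega>. \<forall>\<xi>.
        (\<Sum>j\<in>UNIV. dz j (\<lambda>w. complex_of_real (\<rho> w)) p * \<xi> $ j) = 0 \<longrightarrow>
        0 \<le> form_val (ddbar \<rho> p) \<xi>))"

definition delta_regular :: "(complex^'n) set \<Rightarrow> bool" where
  "delta_regular \<Omega> \<longleftrightarrow> bounded_domain \<Omega> \<and>
    (\<exists>v \<rho>. C2_on \<Omega> v \<and> psh_on \<Omega> v \<and> bounded (v ` \<Omega>) \<and>
      C2_defining_function \<Omega> \<rho> \<and>
      (\<forall>z\<in>\<Omega>. form_le (inverse (\<rho> z) *\<^sub>R ddbar \<rho> z) (ddbar v z)))"

end

theory Submission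
  imports Defs
begin

text \<open>
  Write \<open>\<rho>\<close> for the signed distance to the boundary, which is \<open>C\<^sup>2\<close> near the boundary. As it is
  1-Lipschitz and affine along normals, \<open>\<rho> (z + h) - \<rho> (p + h)\<close> is minimal at \<open>h = 0\<close> if \<open>p\<close> is the
  nearest boundary point of \<open>z \<in> \<Omega>\<close>. Hence \<open>\<rho>\<close> has the same gradient at \<open>z\<close> and \<open>p\<close> and a larger Hessian
  at \<open>z\<close>, so pseudoconvexity at \<open>p\<close> yields the Levi form estimate
  \<open>L\<^sub>\<rho>(\<xi>) \<ge> - C |\<xi>| |\<partial>\<rho>(\<xi>)|\<close> at \<open>z\<close>; a convex increasing reparametrization
  of \<open>\<rho>\<close> extends it to all of \<open>\<Omega>\<close>. The error \<open>|\<xi>| |\<partial>\<rho>(\<xi>)| / |\<rho>|\<close> is split between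
  \<open>|log d|^\<alpha> |\<xi>|\<^sup>2\<close>, which \<open>\<lambda>\<close> and \<open>|z|\<^sup>2\<close> dominate, and \<open>|\<partial>\<rho>(\<xi>)|\<^sup>2 / (\<rho>\<^sup>2 |log d|^\<alpha>)\<close>,
  which is dominated by the function \<open>- (A - log (- \<rho>))^(1 - \<alpha>)\<close>, bounded because \<open>\<alpha> > 1\<close>.
\<close>

subsection \<open>Functions with gradient and Hessian\<close>

text \<open>The Hessian of a \<open>C\<^sup>2\<close> function is merely continuous, so the Levi
  form of an arbitrary defining function at z differs from the one at the nearest boundary point by
  o(1), not by O(d). After division by |\<rho>| such an error need not be dominated by |log
  d|^\<alpha> |\<xi>|^2. The signed distance is used because its Hessian comparison is one-sided and
  costs no error at all. The logarithmic function arises from asking for a bounded function of s =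
  \<rho> with second derivative of order 1 / (s^2 |log(-s)|^\<alpha>): its first derivative is then
  of order 1 / (-s |log(-s)|^\<alpha>), which is integrable at 0 exactly for \<alpha> > 1.
  Composition with \<rho> also produces this first derivative times the Levi form L of \<rho>, a
  term without sign. It is a bounded multiple of the term L / |\<rho>| that must be controlled
  anyway, so one estimate absorbs both.\<close>

definition C1_field :: "'a::real_normed_vector set \<Rightarrow> ('a \<Rightarrow> 'b::real_normed_vector) \<Rightarrow> ('a \<Rightarrow> 'a \<Rightarrow> 'b) \<Rightarrow> bool" where
  "C1_field U f F \<longleftrightarrow>
    (\<forall>z\<in>U. (f has_derivative F z) (at z)) \<and> (\<forall>h. continuous_on U (\<lambda>z. F z h))"

text \<open>Derivatives are stored as a gradient and a Hessian with values in the space itself, so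
  that Levi forms and tests against normals are plain inner products. Continuity is asked for each
  fixed direction; in finite dimension this amounts to continuity in operator norm, see
  \<open>C1_field_blinfun\<close>.\<close>

definition C2_grad ::
  "'a::euclidean_space set \<Rightarrow> ('a \<Rightarrow> real) \<Rightarrow> ('a \<Rightarrow> 'a) \<Rightarrow> ('a \<Rightarrow> 'a \<Rightarrow> 'a) \<Rightarrow> bool" where
  "C2_grad U u g H \<longleftrightarrow>
    (\<forall>z\<in>U. (u has_derivative (\<lambda>h. g z \<bullet> h)) (at z)) \<and> C1_field U g H"

lemma C2_gradD:
  assumes "C2_grad U u g H"
  shows "z \<in> U \<Longrightarrow> (u has_derivative (\<lambda>h. g z \<bullet> h)) (at z)"
    and "z \<in> U \<Longrightarrow> (g has_derivative H z) (at z)"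
    and "continuous_on U (\<lambda>z. H z h)"
  using assms by (auto simp: C2_grad_def C1_field_def)

lemma C2_gradI:
  assumes "\<And>z. z \<in> U \<Longrightarrow> (u has_derivative (\<lambda>h. g z \<bullet> h)) (at z)"
    and "\<And>z. z \<in> U \<Longrightarrow> (g has_derivative H z) (at z)"
    and "\<And>h. continuous_on U (\<lambda>z. H z h)"
  shows "C2_grad U u g H"
  using assms by (auto simp: C2_grad_def C1_field_def)

lemma C2_grad_linear:
  assumes "C2_grad U u g H" "z \<in> U"
  shows "linear (H z)"
  using C2_gradD(2)[OF assms] has_derivative_linear by blast

lemma C2_grad_subset: "C2_grad U u g H \<Longrightarrow> V \<subseteq> U \<Longrightarrow> C2_grad V u g H"
  by (auto simp: C2_grad_def C1_field_def intro: continuous_on_subset)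

lemma C2_grad_continuous:
  assumes "C2_grad U u g H"
  shows "continuous_on U u" "continuous_on U g"
  using has_derivative_continuous[OF C2_gradD(1)[OF assms]]
    has_derivative_continuous[OF C2_gradD(2)[OF assms]]
  by (simp_all add: continuous_at_imp_continuous_on)

lemma C1_field_blinfun:
  fixes f :: "'a::euclidean_space \<Rightarrow> 'b::real_normed_vector"
  assumes "C1_field U f F"
  shows "\<exists>F'. (\<forall>z\<in>U. blinfun_apply (F' z) = F z) \<and> continuous_on U F'"
proof -
  let ?F = "\<lambda>z. Blinfun (F z)"
  have bl: "bounded_linear (F z)" if "z \<in> U" for z
    using assms that by (auto simp: C1_field_def dest: has_derivative_bounded_linear)
  have app: "blinfun_apply (?F z) = F z" if "z \<in> U" for z
    using bl[OF that] by (rule bounded_linear_Blinfun_apply)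
  have "continuous_on U ?F"
  proof (rule continuous_on_blinfun_componentwise)
    fix i :: 'a
    have "continuous_on U (\<lambda>z. F z i)"
      using assms by (auto simp: C1_field_def)
    then show "continuous_on U (\<lambda>z. blinfun_apply (?F z) i)"
      by (rule continuous_on_eq) (simp add: app)
  qed
  with app show ?thesis by (intro exI[of _ ?F]) simp
qed

lemma C2_on_iff_grad:
  fixes u :: "'a::euclidean_space \<Rightarrow> real"
  shows "C2_on U u \<longleftrightarrow> (\<exists>g H. C2_grad U u g H)"
proof
  assume "C2_on U u"
  then obtain u' u'' where u:
    "\<And>z. z \<in> U \<Longrightarrow> (u has_derivative blinfun_apply (u' z)) (at z)"
    "\<And>z. z \<in> U \<Longrightarrow> (u' has_derivative blinfun_apply (u'' z)) (at z)"
    "continuous_on U u''"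
    unfolding C2_on_def by blast
  let ?g = "\<lambda>z. \<Sum>b\<in>Basis. u' z b *\<^sub>R b"
  let ?H = "\<lambda>z h. \<Sum>b\<in>Basis. u'' z h b *\<^sub>R b"
  have "C2_grad U u ?g ?H"
  proof (rule C2_gradI)
    fix z assume z: "z \<in> U"
    have "?g z \<bullet> h = u' z h" for h
    proof -
      have "u' z h = u' z (\<Sum>b\<in>Basis. (h \<bullet> b) *\<^sub>R b)"
        by (simp add: euclidean_representation)
      also have "\<dots> = ?g z \<bullet> h"
        by (simp add: blinfun.sum_right blinfun.scaleR_right inner_sum_left inner_sum_right inner_commute mult.commute)
      finally show ?thesis by simp
    qed
    then show "(u has_derivative (\<lambda>h. ?g z \<bullet> h)) (at z)"
      using u(1)[OF z] by simp
    show "(?g has_derivative ?H z) (at z)"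
      by (auto intro!: derivative_eq_intros u(2)[OF z] simp: fun_eq_iff)
  next
    fix h
    show "continuous_on U (\<lambda>z. ?H z h)"
      by (intro continuous_intros u(3))
  qed
  then show "\<exists>g H. C2_grad U u g H" by blast
next
  assume "\<exists>g H. C2_grad U u g H"
  then obtain g H where gH: "C2_grad U u g H" by blast
  then have "C1_field U g H" by (simp add: C2_grad_def)
  from C1_field_blinfun[OF this] obtain H' where H':
    "\<And>z. z \<in> U \<Longrightarrow> blinfun_apply (H' z) = H z" "continuous_on U H'"
    by blast
  let ?L = "blinfun_inner_left :: 'a \<Rightarrow> 'a \<Rightarrow>\<^sub>L real"
  have bl: "bounded_linear ?L"
    by (rule bounded_linear_blinfun_inner_left)
  show "C2_on U u"
    unfolding C2_on_def
  proof (intro exI conjI ballI)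
    fix z assume z: "z \<in> U"
    show "(u has_derivative blinfun_apply (?L (g z))) (at z)"
      using C2_gradD(1)[OF gH z] by (simp add: inner_commute)
    have "((\<lambda>z. ?L (g z)) has_derivative (\<lambda>h. ?L (H z h))) (at z)"
      by (rule bounded_linear.has_derivative[OF bl C2_gradD(2)[OF gH z]])
    then show "((\<lambda>z. ?L (g z)) has_derivative blinfun_apply (Blinfun ?L o\<^sub>L H' z)) (at z)"
      by (rule has_derivative_eq_rhs) (simp add: fun_eq_iff bounded_linear_Blinfun_apply[OF bl] H'(1)[OF z])
  next
    show "continuous_on U (\<lambda>z. Blinfun ?L o\<^sub>L H' z)"
      by (intro continuous_intros H')
  qed
qed

subsection \<open>The Levi form\<close>

text \<open>Adding the values of a real quadratic form at \<open>\<xi>\<close> and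
  \<open>\<i> *s \<xi>\<close> cancels its (2,0) and (0,2) parts and leaves the Hermitian one. The
  factor 1/4 collects the two halves in the Wirtinger derivatives.\<close>

abbreviation levi :: "(complex^'n \<Rightarrow> complex^'n) \<Rightarrow> complex^'n \<Rightarrow> real" where
  "levi A \<xi> \<equiv> (A \<xi> \<bullet> \<xi> + A (\<i> *s \<xi>) \<bullet> (\<i> *s \<xi>)) / 4"

lemma complex_vec_expansion:
  fixes \<xi> :: "complex^'n"
  shows "\<xi> = (\<Sum>j\<in>UNIV. Re (\<xi> $ j) *\<^sub>R axis j 1 + Im (\<xi> $ j) *\<^sub>R axis j \<i>)"
proof -
  have "(\<Sum>j\<in>UNIV. Re (\<xi> $ j) *\<^sub>R axis j 1 + Im (\<xi> $ j) *\<^sub>R axis j \<i>) $ k = \<xi> $ k" for k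
  proof -
    have "(\<Sum>j\<in>UNIV. Re (\<xi> $ j) *\<^sub>R axis j 1 + Im (\<xi> $ j) *\<^sub>R axis j \<i>) $ k
      = (\<Sum>j\<in>UNIV. if j = k then \<xi> $ k else 0)"
      unfolding sum_component
      by (rule sum.cong) (auto simp: axis_def complex_eq_iff)
    then show ?thesis by simp
  qed
  then show ?thesis by (simp add: vec_eq_iff)
qed

lemma form_val_ddbar:
  fixes u :: "complex^'n \<Rightarrow> real"
  assumes U: "open U" "z \<in> U" and u: "C2_grad U u g H"
  shows "form_val (ddbar u z) \<xi> = levi (H z) \<xi>"
proof -
  have lin: "linear (H z)" by (rule C2_grad_linear[OF u U(2)])
  define e f where "e k = axis k (1::complex)" and "f k = axis k \<i>" for k :: 'n
  have dzbar: "dzbar k (\<lambda>w. complex_of_real (u w)) w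
      = (of_real (g w \<bullet> e k) + \<i> * of_real (g w \<bullet> f k)) / 2" if "w \<in> U" for k w
  proof -
    have "((\<lambda>w. complex_of_real (u w)) has_derivative (\<lambda>h. of_real (g w \<bullet> h))) (at w)"
      by (rule bounded_linear.has_derivative[OF bounded_linear_of_real C2_gradD(1)[OF u that]])
    from frechet_derivative_at[OF this, symmetric] show ?thesis by (simp add: dzbar_def e_def f_def)
  qed
  have der: "frechet_derivative (dzbar k (\<lambda>w. complex_of_real (u w))) (at z) h
      = (of_real (H z h \<bullet> e k) + \<i> * of_real (H z h \<bullet> f k)) / 2" for k h
  proof -
    have "((\<lambda>w. (complex_of_real (g w \<bullet> e k) + \<i> * of_real (g w \<bullet> f k)) / 2) has_derivative
        (\<lambda>h. (of_real (H z h \<bullet> e k) + \<i> * of_real (H z h \<bullet> f k)) / 2)) (at z)"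
      using C2_gradD(2)[OF u U(2)]
      by (auto intro!: derivative_eq_intros)
    then have "(dzbar k (\<lambda>w. complex_of_real (u w)) has_derivative
        (\<lambda>h. (of_real (H z h \<bullet> e k) + \<i> * of_real (H z h \<bullet> f k)) / 2)) (at z)"
      by (rule has_derivative_transform_within_open[OF _ U]) (simp add: dzbar)
    from fun_cong[OF frechet_derivative_at[OF this], of h] show ?thesis
      by simp
  qed
  define a b where "a j = Re (\<xi> $ j)" and "b j = Im (\<xi> $ j)" for j
  \<comment> \<open>\<open>X j\<close> and \<open>Y j\<close> are the parts of \<open>\<xi>\<close>
    and \<open>\<i> *s \<xi>\<close> in the j-th complex coordinate. The identity holds for each
    pair j, k separately; the rest is bilinearity.\<close>
  define X Y where "X j = a j *\<^sub>R e j + b j *\<^sub>R f j" and "Y j = a j *\<^sub>R f j - b j *\<^sub>R e j" for j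
  have entry: "Re (ddbar u z $ j $ k * \<xi> $ j * cnj (\<xi> $ k))
    = (H z (X j) \<bullet> X k + H z (Y j) \<bullet> Y k) / 4" for j k
  proof -
    define p q r s where "p = H z (e j) \<bullet> e k" and "q = H z (e j) \<bullet> f k"
      and "r = H z (f j) \<bullet> e k" and "s = H z (f j) \<bullet> f k"
    have "ddbar u z $ j $ k = Complex ((p + s) / 4) ((q - r) / 4)"
      by (simp add: ddbar_def dz_def der e_def[symmetric] f_def[symmetric] p_def q_def r_def s_def complex_eq_iff)
    then have "Re (ddbar u z $ j $ k * \<xi> $ j * cnj (\<xi> $ k))
      = ((p + s) * (a j * a k + b j * b k) + (q - r) * (a j * b k - b j * a k)) / 4"
      by (simp add: a_def b_def algebra_simps add_divide_distrib diff_divide_distrib)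
    moreover have "H z (X j) \<bullet> X k = a j * a k * p + a j * b k * q + b j * a k * r + b j * b k * s"
      by (simp add: X_def p_def q_def r_def s_def linear_add[OF lin] linear_cmul[OF lin]
        inner_add_left inner_add_right distrib_left ac_simps)
    moreover have "H z (Y j) \<bullet> Y k = a j * a k * s - a j * b k * r - b j * a k * q + b j * b k * p"
      by (simp add: Y_def p_def q_def r_def s_def linear_diff[OF lin] linear_cmul[OF lin]
        inner_diff_left inner_diff_right algebra_simps)
    ultimately show ?thesis
      by (simp add: algebra_simps)
  qed
  have X: "\<xi> = (\<Sum>j\<in>UNIV. X j)"
    using complex_vec_expansion[of \<xi>] by (simp add: X_def a_def b_def e_def f_def)
  have Y: "\<i> *s \<xi> = (\<Sum>j\<in>UNIV. Y j)"
    using complex_vec_expansion[of "\<i> *s \<xi>"] by (simp add: Y_def a_def b_def e_def f_def algebra_simps)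
  have "form_val (ddbar u z) \<xi> = (\<Sum>j\<in>UNIV. \<Sum>k\<in>UNIV. (H z (X j) \<bullet> X k + H z (Y j) \<bullet> Y k) / 4)"
    by (simp only: form_val_def Re_sum entry)
  also have "\<dots> = ((\<Sum>j\<in>UNIV. \<Sum>k\<in>UNIV. H z (X j) \<bullet> X k)
      + (\<Sum>j\<in>UNIV. \<Sum>k\<in>UNIV. H z (Y j) \<bullet> Y k)) / 4"
    by (simp only: sum_divide_distrib[symmetric] sum.distrib)
  also have "\<dots> = levi (H z) \<xi>"
    unfolding Y unfolding X
    by (simp only: linear_sum[OF lin] inner_sum_left) (simp only: inner_sum_right)
  finally show ?thesis .
qed

subsection \<open>Plurisubharmonicity from a nonnegative Levi form\<close>

text \<open>The derivative is taken within the interval because circles of radius r are known to lie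
  in the set only for r in [0, 1], so at the ends only one-sided derivatives make sense.\<close>

lemma mono_within:
  fixes f :: "real \<Rightarrow> real"
  assumes "a \<le> r" "r \<le> b"
    and "\<And>x. x \<in> {a..b} \<Longrightarrow> (f has_real_derivative f' x) (at x within {a..b})"
    and "\<And>x. x \<in> {a..b} \<Longrightarrow> 0 \<le> f' x"
  shows "f a \<le> f r"
proof -
  have "\<exists>x\<in>{a..r}. f r - f a = (*) (f' x) (r - a)"
  proof (rule mvt_very_simple[OF assms(1)])
    fix x assume "a \<le> x" "x \<le> r"
    then show "(f has_derivative (*) (f' x)) (at x within {a..r})"
      using assms(3)[of x] assms(2)
      by (auto simp: has_field_derivative_def intro: has_derivative_subset)
  qed
  then obtain x where x: "x \<in> {a..r}" "f r - f a = f' x * (r - a)" by blast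
  moreover have "0 \<le> f' x * (r - a)"
    using assms(1,2) assms(4)[of x] x(1) by simp
  ultimately show ?thesis by linarith
qed

lemma norm_vector_scalar_mult: "norm (c *s b) = cmod c * norm (b :: complex^'n)"
  by (simp add: norm_vec_def L2_set_def norm_mult power_mult_distrib sum_distrib_left[symmetric] real_sqrt_mult)

lemma bounded_linear_vector_scalar_mult_left: "bounded_linear (\<lambda>c. c *s (b :: complex^'n))"
  by (rule bounded_linear_intro[where K="norm b"])
    (simp_all add: norm_vector_scalar_mult, simp_all add: vec_eq_iff algebra_simps)

lemma bounded_linear_vector_scalar_mult_right: "bounded_linear (\<lambda>b :: complex^'n. c *s b)"
  by (rule bounded_linear_intro[where K="cmod c"])
    (simp_all add: norm_vector_scalar_mult vec_eq_iff algebra_simps)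

text \<open>With \<open>m(r)\<close> the integral of \<open>u\<close> over the circle of radius \<open>r\<close>, the angular derivative integrates to zero,
  which turns \<open>(r m')'\<close> into \<open>r\<close> times the integral of the Laplacian.\<close>

lemma submean_of_levi:
  fixes u :: "complex^'n \<Rightarrow> real"
  assumes u: "C2_grad S u g H"
    and levi: "\<And>z \<xi>. z \<in> S \<Longrightarrow> 0 \<le> levi (H z) \<xi>"
    and sub: "\<And>\<zeta>. \<zeta> \<in> cball 0 1 \<Longrightarrow> a + \<zeta> *s b \<in> S"
  shows "(\<lambda>t. u (a + cis t *s b)) integrable_on {0..2 * pi}"
    and "u a \<le> integral {0..2 * pi} (\<lambda>t. u (a + cis t *s b)) / (2 * pi)"
proof -
  note bl = bounded_linear_vector_scalar_mult_left[of b]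
  define e where "e t = cis t *s b" for t
  define P where "P r t = a + r *\<^sub>R e t" for r t
  have PS: "P r t \<in> S" if "r \<in> {0..1}" for r t
    using sub[of "of_real r * cis t"] that
    by (simp add: P_def e_def norm_mult scaleR_vec_def vector_scalar_mult_def scaleR_conv_of_real mult.assoc)
  \<comment> \<open>Continuity of \<open>H\<close> in fixed directions is not directly applicable
    below, where the direction \<open>e t\<close> moves along with the point; the operator-valued
    version gives joint continuity in (r, t).\<close>
  from C1_field_blinfun[of S g H] u obtain H' where H':
    "\<And>z. z \<in> S \<Longrightarrow> blinfun_apply (H' z) = H z" "continuous_on S H'"
    unfolding C2_grad_def by blast
  have de: "(e has_derivative (\<lambda>s. s *\<^sub>R (\<i> *s e t))) (at t within A)" for t A
    unfolding e_def[abs_def]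
    by (rule has_derivative_eq_rhs,
        rule bounded_linear.has_derivative[OF bl has_derivative_cis[OF has_derivative_ident]])
      (simp add: fun_eq_iff vec_eq_iff)
  have conte: "continuous_on A e" for A
    using has_derivative_continuous[OF de] by (auto simp: continuous_on_eq_continuous_within)
  have contP: "continuous_on A (\<lambda>(r, t). P r t)" for A
    unfolding P_def split_def
    by (intro continuous_intros continuous_on_compose2[OF conte[of UNIV]]) auto
  let ?Q = "{0..1} \<times> cbox 0 (2 * pi) :: (real \<times> real) set"
  have sub': "(\<lambda>(r, t). P r t) ` ?Q \<subseteq> S" using PS by auto
  have contu: "continuous_on ?Q (\<lambda>(r, t). u (P r t))"
    using continuous_on_compose2[OF C2_grad_continuous(1)[OF u] contP sub'] by (simp add: split_def)
  have contg: "continuous_on ?Q (\<lambda>(r, t). g (P r t))"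
    using continuous_on_compose2[OF C2_grad_continuous(2)[OF u] contP sub'] by (simp add: split_def)
  have contH: "continuous_on ?Q (\<lambda>(r, t). H' (P r t))"
    using continuous_on_compose2[OF H'(2) contP sub'] by (simp add: split_def)
  have conte': "continuous_on A (\<lambda>(r::real, t). e t)" for A
    unfolding split_def by (intro continuous_on_compose2[OF conte[of UNIV]] continuous_intros) auto
  have slice: "continuous_on (cbox 0 (2 * pi)) (F r)" if "r \<in> {0..1}" "continuous_on ?Q (\<lambda>(r, t). F r t)"
    for F :: "real \<Rightarrow> real \<Rightarrow> real" and r
  proof -
    have "continuous_on (cbox 0 (2 * pi)) (\<lambda>t. (\<lambda>(r, t). F r t) (r, t))"
      by (rule continuous_on_compose2[OF that(2)]) (use that(1) in \<open>auto intro!: continuous_intros\<close>)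
    then show ?thesis by simp
  qed
  define fr where "fr r t = g (P r t) \<bullet> e t" for r t
  define frr where "frr r t = H' (P r t) (e t) \<bullet> e t" for r t
  define ftt where "ftt r t = H' (P r t) (\<i> *s e t) \<bullet> (\<i> *s e t)" for r t
  have cfr: "continuous_on ?Q (\<lambda>(r, t). fr r t)"
    using contg conte'[of ?Q] unfolding fr_def split_def by (intro continuous_intros)
  have cfrr: "continuous_on ?Q (\<lambda>(r, t). frr r t)"
    using contH conte'[of ?Q] unfolding frr_def split_def by (intro continuous_intros)
  have cftt: "continuous_on ?Q (\<lambda>(r, t). ftt r t)"
    using contH conte'[of ?Q] unfolding ftt_def split_def
    by (intro continuous_intros bounded_linear.continuous_on[OF bounded_linear_vector_scalar_mult_right])
  note int = integrable_continuous[OF slice]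
  have du: "((\<lambda>r. u (P r t)) has_real_derivative fr r t) (at r within {0..1})" if "r \<in> {0..1}" for r t
  proof -
    have "((\<lambda>r. P r t) has_derivative (\<lambda>s. s *\<^sub>R e t)) (at r within {0..1})"
      unfolding P_def by (auto intro!: derivative_eq_intros)
    from has_derivative_compose[OF this C2_gradD(1)[OF u PS[OF that]]]
    show ?thesis
      unfolding has_field_derivative_def by (rule has_derivative_eq_rhs) (simp add: fr_def fun_eq_iff)
  qed
  have dg: "((\<lambda>r. fr r t) has_real_derivative frr r t) (at r within {0..1})" if "r \<in> {0..1}" for r t
  proof -
    have "((\<lambda>r. P r t) has_derivative (\<lambda>s. s *\<^sub>R e t)) (at r within {0..1})"
      unfolding P_def by (auto intro!: derivative_eq_intros)
    from has_derivative_compose[OF this C2_gradD(2)[OF u PS[OF that]]]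
    have "((\<lambda>r. g (P r t)) has_derivative (\<lambda>s. H' (P r t) (s *\<^sub>R e t))) (at r within {0..1})"
      by (simp add: H'(1)[OF PS[OF that]])
    from has_derivative_inner_left[OF this, of "e t"] 
    show ?thesis
      unfolding has_field_derivative_def fr_def[abs_def]
      by (rule has_derivative_eq_rhs) (simp add: frr_def blinfun.scaleR_right fun_eq_iff)
  qed
  let ?I = "integral (cbox 0 (2 * pi))"
  have dm: "((\<lambda>r. ?I (\<lambda>t. u (P r t))) has_real_derivative ?I (fr r)) (at r within {0..1})"
    if "r \<in> {0..1}" for r
    by (rule leibniz_rule_field_derivative[where fx=fr])
      (use du cfr that int[OF _ contu] in auto)
  have dn: "((\<lambda>r. ?I (fr r)) has_real_derivative ?I (frr r)) (at r within {0..1})"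
    if "r \<in> {0..1}" for r
    by (rule leibniz_rule_field_derivative[where fx=frr])
      (use dg cfrr that int[OF _ cfr] in auto)
  have angular: "?I (fr r) = r * ?I (ftt r)" if r: "r \<in> {0..1}" for r
  proof -
    \<comment> \<open>Moving the point \<open>P r t\<close> yields r times the second derivative in
      the angular direction; differentiating \<open>\<i> *s e t\<close> yields \<open>- e t\<close>,
      hence minus the radial derivative.\<close>
    have "((\<lambda>t. g (P r t) \<bullet> (\<i> *s e t)) has_vector_derivative (r * ftt r t - fr r t)) (at t within {0..2*pi})"
      for t
    proof -
      have dP: "(P r has_derivative (\<lambda>s. s *\<^sub>R r *\<^sub>R (\<i> *s e t))) (at t within {0..2*pi})"
        unfolding P_def by (auto intro!: derivative_eq_intros de simp: fun_eq_iff)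
      have 1: "((\<lambda>t. g (P r t)) has_derivative (\<lambda>s. H' (P r t) (s *\<^sub>R r *\<^sub>R (\<i> *s e t)))) (at t within {0..2*pi})"
        using has_derivative_compose[OF dP C2_gradD(2)[OF u PS[OF r]]]
        by (simp add: H'(1)[OF PS[OF r]])
      have 2: "((\<lambda>t. \<i> *s e t) has_derivative (\<lambda>s. \<i> *s (s *\<^sub>R (\<i> *s e t)))) (at t within {0..2*pi})"
        by (rule bounded_linear.has_derivative[OF bounded_linear_vector_scalar_mult_right de])
      have neg: "\<i> *s (s *\<^sub>R (\<i> *s e t)) = - (s *\<^sub>R e t)" for s
        by (simp add: vec_eq_iff)
      from has_derivative_inner[OF 1 2] show ?thesis
        unfolding has_vector_derivative_def
        by (rule has_derivative_eq_rhs)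
          (simp add: neg fr_def ftt_def blinfun.scaleR_right algebra_simps fun_eq_iff)
    qed
    from fundamental_theorem_of_calculus[OF _ this]
    have hi: "((\<lambda>t. r * ftt r t - fr r t) has_integral 0) {0..2*pi}"
      by (simp add: P_def e_def cis_2pi)
    have "0 = ?I (\<lambda>t. r * ftt r t - fr r t)"
      using integral_unique[OF hi] by simp
    also have "\<dots> = r * ?I (ftt r) - ?I (fr r)"
      using int[OF r cftt] int[OF r cfr]
      by (subst integral_diff) (auto intro: integrable_on_mult_right)
    finally show ?thesis by simp
  qed
  have pos: "0 \<le> ?I (frr r) + ?I (ftt r)" if r: "r \<in> {0..1}" for r
  proof -
    have "?I (frr r) + ?I (ftt r) = ?I (\<lambda>t. frr r t + ftt r t)"
      by (rule integral_add[symmetric]) (use int[OF r cfrr] int[OF r cftt] in auto)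
    also have "\<dots> \<ge> 0"
    proof (rule integral_nonneg)
      show "(\<lambda>t. frr r t + ftt r t) integrable_on cbox 0 (2 * pi)"
        by (rule integrable_add) (use int[OF r cfrr] int[OF r cftt] in auto)
      show "0 \<le> frr r t + ftt r t" for t
        using levi[OF PS[OF r, of t], of "e t"] by (simp add: frr_def ftt_def H'(1)[OF PS[OF r]])
    qed
    finally show ?thesis .
  qed
  have rn: "0 \<le> r * ?I (fr r)" if "r \<in> {0..1}" for r
  proof -
    have "0 * ?I (fr 0) \<le> r * ?I (fr r)"
    proof (rule mono_within[where a = 0 and b = 1 and f = "\<lambda>r. r * ?I (fr r)"])
      fix x :: real assume x: "x \<in> {0..1}"
      show "((\<lambda>r. r * ?I (fr r)) has_real_derivative x * (?I (frr x) + ?I (ftt x))) (at x within {0..1})"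
        using DERIV_mult[OF DERIV_ident dn[OF x]]
        by (rule DERIV_cong) (use angular[OF x] in \<open>simp add: algebra_simps\<close>)
      show "0 \<le> x * (?I (frr x) + ?I (ftt x))"
        using x pos[OF x] by simp
    qed (use that in auto)
    then show ?thesis by simp
  qed
  \<comment> \<open>The factor r cannot be divided out at r = 0; there \<open>angular\<close> itself
    shows that the integral vanishes.\<close>
  have n: "0 \<le> ?I (fr r)" if r: "r \<in> {0..1}" for r
  proof (cases "r = 0")
    case True
    then show ?thesis using angular[OF r] by simp
  next
    case False
    then show ?thesis using rn[OF r] r by (simp add: zero_le_mult_iff)
  qed
  have "?I (\<lambda>t. u (P 0 t)) \<le> ?I (\<lambda>t. u (P 1 t))"
    by (rule mono_within[where a = 0 and b = 1, OF _ _ dm n]) auto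
  then have "2 * pi * u a \<le> integral {0..2 * pi} (\<lambda>t. u (a + cis t *s b))"
    by (simp add: P_def e_def)
  then show "u a \<le> integral {0..2 * pi} (\<lambda>t. u (a + cis t *s b)) / (2 * pi)"
    by (simp add: field_simps)
  show "(\<lambda>t. u (a + cis t *s b)) integrable_on {0..2 * pi}"
    using int[OF _ contu, of 1] by (simp add: P_def e_def)
qed

lemma psh_on_of_levi:
  fixes u :: "complex^'n \<Rightarrow> real"
  assumes u: "C2_grad S u g H"
    and levi: "\<And>z \<xi>. z \<in> S \<Longrightarrow> 0 \<le> levi (H z) \<xi>"
  shows "psh_on S u"
  unfolding psh_on_def
proof (intro conjI allI impI)
  fix c
  have "{z \<in> S. u z < c} = S \<inter> u -` {..<c}" by auto
  then show "openin (top_of_set S) {z \<in> S. u z < c}"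
    using continuous_openin_preimage_gen[OF C2_grad_continuous(1)[OF u], of "{..<c}"] by simp
next
  fix a b
  assume "\<forall>\<zeta>\<in>cball 0 1. a + \<zeta> *s b \<in> S"
  then show "(\<lambda>t. u (a + cis t *s b)) integrable_on {0..2 * pi}"
    and "u a \<le> integral {0..2 * pi} (\<lambda>t. u (a + cis t *s b)) / (2 * pi)"
    using submean_of_levi[OF u levi] by blast+
qed

subsection \<open>The signed distance function\<close>

text \<open>If the component \<open>u\<close> of \<open>n\<close> orthogonal to \<open>w\<close>
  were nonzero, the test vectors \<open>w + M *\<^sub>R u\<close> would make the inner product with
  \<open>n\<close> positive for large \<open>M\<close>. Thus \<open>n\<close> lies on the line of
  \<open>w\<close>, and testing with \<open>w\<close> fixes the sign.\<close>

lemma halfspace_containment: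
  fixes n w :: "'a::real_inner"
  assumes "w \<noteq> 0" and neg: "\<And>v. 0 < w \<bullet> v \<Longrightarrow> n \<bullet> v \<le> 0"
  shows "\<exists>k\<ge>0. n = - k *\<^sub>R w"
proof -
  define c u where "c = n \<bullet> w / (w \<bullet> w)" and "u = n - c *\<^sub>R w"
  have ww: "0 < w \<bullet> w" using assms(1) by simp
  have wu: "w \<bullet> u = 0"
    using ww by (simp add: u_def c_def inner_diff_right inner_commute)
  have nu: "n \<bullet> u = u \<bullet> u"
    using wu by (simp add: u_def inner_diff_left inner_diff_right inner_commute)
  have "n \<bullet> w + M * (u \<bullet> u) \<le> 0" for M
    using neg[of "w + M *\<^sub>R u"] ww wu nu by (simp add: inner_add_right)
  from this[of "(1 - n \<bullet> w) / (u \<bullet> u)"] have "u \<bullet> u = 0"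
    by (cases "u \<bullet> u = 0") simp_all
  then have "n = c *\<^sub>R w" by (simp add: u_def)
  moreover have "c \<le> 0"
    using neg[of w] ww by (simp add: c_def divide_nonpos_pos)
  ultimately show ?thesis by (intro exI[of _ "- c"]) simp
qed

lemma eventually_less_along_direction:
  fixes r :: "'a::real_inner \<Rightarrow> real"
  assumes "(r has_derivative (\<lambda>h. g \<bullet> h)) (at q)" "0 < g \<bullet> v"
  shows "\<forall>\<^sub>F \<epsilon> in at_right 0. r q < r (q + \<epsilon> *\<^sub>R v)"
proof -
  have "((\<lambda>\<epsilon>. q + \<epsilon> *\<^sub>R v) has_derivative (\<lambda>s. s *\<^sub>R v)) (at 0)"
    by (auto intro!: derivative_eq_intros)
  from has_derivative_compose[OF this, of r "\<lambda>h. g \<bullet> h"] assms(1)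
  have "((\<lambda>\<epsilon>. r (q + \<epsilon> *\<^sub>R v)) has_derivative (\<lambda>s. g \<bullet> (s *\<^sub>R v))) (at 0)" by simp
  then have "((\<lambda>\<epsilon>. r (q + \<epsilon> *\<^sub>R v)) has_real_derivative g \<bullet> v) (at 0)"
    unfolding has_field_derivative_def by (rule has_derivative_eq_rhs) (simp add: fun_eq_iff)
  from has_real_derivative_pos_inc_right[OF this assms(2)] obtain d where
    "d > 0" "\<forall>h>0. h < d \<longrightarrow> r (q + 0 *\<^sub>R v) < r (q + h *\<^sub>R v)"
    by auto
  then show ?thesis
    unfolding eventually_at_right_field by auto
qed

text \<open>The difference v of the two preimages of \<open>k\<close> satisfies A y v = (A y0 - A y)
  x, where x is the preimage at y0. A lower bound m |v| for A y0 survives as (m / 2) |v| for nearby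
  y, so v tends to 0.\<close>

lemma continuous_on_inv_blinfun:
  fixes A :: "'b::t2_space \<Rightarrow> 'a::euclidean_space \<Rightarrow>\<^sub>L 'a"
  assumes A: "continuous_on V A" and bij: "\<And>y. y \<in> V \<Longrightarrow> bij (blinfun_apply (A y))"
  shows "continuous_on V (\<lambda>y. inv (blinfun_apply (A y)) k)"
  unfolding continuous_on_def
proof
  fix y0 assume y0: "y0 \<in> V"
  let ?T = "A y0"
  let ?x = "inv (blinfun_apply ?T) k"
  obtain m where m: "m > 0" "\<And>v. m * norm v \<le> norm (?T v)"
    using linear_inj_bounded_below_pos[of "blinfun_apply ?T"] bij[OF y0]
    by (auto simp: bij_def blinfun.bounded_linear_right bounded_linear.linear)
  have lim: "((\<lambda>y. norm (?T - A y)) \<longlongrightarrow> 0) (at y0 within V)"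
  proof -
    have "((\<lambda>y. norm (?T - A y)) \<longlongrightarrow> norm (?T - ?T)) (at y0 within V)"
      using A y0 by (intro tendsto_intros) (auto simp: continuous_on_def)
    then show ?thesis by simp
  qed
  have inV: "\<forall>\<^sub>F y in at y0 within V. y \<in> V"
    by (auto simp: eventually_at_topological)
  have "\<forall>\<^sub>F y in at y0 within V. norm (inv (blinfun_apply (A y)) k - ?x) \<le> 2 / m * norm ?x * norm (?T - A y)"
    using order_tendstoD(2)[OF lim half_gt_zero[OF m(1)]] inV
  proof (rule eventually_elim2)
    fix y assume near: "norm (?T - A y) < m / 2" and y: "y \<in> V"
    define v where "v = inv (blinfun_apply (A y)) k - ?x"
    have "A y v = (?T - A y) ?x"
      using bij[OF y] bij[OF y0]
      by (simp add: v_def blinfun.diff_right blinfun.diff_left bij_is_surj surj_f_inv_f)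
    then have 1: "norm (A y v) \<le> norm (?T - A y) * norm ?x"
      by (simp add: norm_blinfun)
    have "norm (?T v) \<le> norm (A y v) + norm ((?T - A y) v)"
      using norm_triangle_ineq[of "A y v" "(?T - A y) v"] by (simp add: blinfun.diff_left)
    also have "norm ((?T - A y) v) \<le> norm (?T - A y) * norm v"
      by (rule norm_blinfun)
    also have "norm (?T - A y) * norm v \<le> m / 2 * norm v"
      using near by (intro mult_right_mono) auto
    finally have "m / 2 * norm v \<le> norm (A y v)"
      using m(2)[of v] by simp
    with 1 have "m / 2 * norm v \<le> norm (?T - A y) * norm ?x" by linarith
    then have "norm v \<le> 2 / m * norm ?x * norm (?T - A y)"
      using m(1) by (simp add: field_simps)
    then show "norm (inv (blinfun_apply (A y)) k - ?x) \<le> 2 / m * norm ?x * norm (?T - A y)"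
      by (simp add: v_def)
  qed
  moreover have "((\<lambda>y. 2 / m * norm ?x * norm (?T - A y)) \<longlongrightarrow> 0) (at y0 within V)"
    by (rule tendsto_mult_right_zero[OF lim])
  ultimately have "((\<lambda>y. inv (blinfun_apply (A y)) k - ?x) \<longlongrightarrow> 0) (at y0 within V)"
    by (rule Lim_null_comparison)
  then show "((\<lambda>y. inv (blinfun_apply (A y)) k) \<longlongrightarrow> ?x) (at y0 within V)"
    by (rule LIM_zero_cancel)
qed

lemma has_gradient_unique:
  fixes g g' :: "'a::euclidean_space"
  assumes "(u has_derivative (\<lambda>h. g \<bullet> h)) (at z)" "(u has_derivative (\<lambda>h. g' \<bullet> h)) (at z)"
  shows "g = g'"
  using has_derivative_unique[OF assms] by (simp add: fun_eq_iff vector_eq_rdot)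

lemma C2_grad_unique:
  assumes "open V" "open V'" "z \<in> V" "z \<in> V'" and g: "C2_grad V u g H" and g': "C2_grad V' u g' H'"
  shows "g z = g' z" "H z = H' z"
proof -
  have eq: "g w = g' w" if "w \<in> V \<inter> V'" for w
    using C2_gradD(1)[OF g, of w] C2_gradD(1)[OF g', of w] that by (blast intro: has_gradient_unique)
  then show "g z = g' z" using assms by blast
  have "(g has_derivative H' z) (at z)"
    by (rule has_derivative_transform_within_open[OF C2_gradD(2)[OF g' assms(4)] open_Int[OF assms(1,2)]])
      (use assms eq in auto)
  with C2_gradD(2)[OF g assms(3)] show "H z = H' z" by (rule has_derivative_unique)
qed

text \<open>Gradients and Hessians are determined by the function near a point, so the local choices
  agree on overlaps. Evaluating each choice at its own base point therefore gives a global
  one.\<close>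

lemma C2_grad_local:
  fixes u :: "'a::euclidean_space \<Rightarrow> real"
  assumes W: "open W"
    and loc: "\<And>z. z \<in> W \<Longrightarrow> \<exists>V g H. open V \<and> z \<in> V \<and> C2_grad V u g H"
  shows "\<exists>g H. C2_grad W u g H"
proof -
  from loc obtain V G K where VG: "\<And>z. z \<in> W \<Longrightarrow> open (V z) \<and> z \<in> V z \<and> C2_grad (V z) u (G z) (K z)"
    by metis
  have eq: "G w w = G z w" "K w w = K z w" if "z \<in> W" "w \<in> W" "w \<in> V z" for z w
    using C2_grad_unique[of "V w" "V z" w u "G w" "K w" "G z" "K z"] VG that by auto
  have "C2_grad W u (\<lambda>z. G z z) (\<lambda>z. K z z)"
  proof (rule C2_gradI)
    fix z assume z: "z \<in> W"
    show "(u has_derivative (\<bullet>) (G z z)) (at z)"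
      using C2_gradD(1)[of "V z" u "G z" "K z" z] VG z by blast
    show "((\<lambda>w. G w w) has_derivative K z z) (at z)"
    proof (rule has_derivative_transform_within_open[of "G z" _ _ _ "W \<inter> V z"])
      show "(G z has_derivative K z z) (at z)"
        using C2_gradD(2)[of "V z" u "G z" "K z" z] VG z by blast
      show "open (W \<inter> V z)" using W VG z by blast
    qed (use z VG eq(1) in auto)
  next
    fix k
    have "isCont (\<lambda>z. K z z k) z" if z: "z \<in> W" for z
    proof -
      have "continuous_on (W \<inter> V z) (\<lambda>w. K z w k)"
        using C2_gradD(3)[of "V z" u "G z" "K z" k] VG z by (blast intro: continuous_on_subset)
      then have "continuous_on (W \<inter> V z) (\<lambda>w. K w w k)"
        by (rule continuous_on_eq) (use eq(2) z in auto)
      moreover have "open (W \<inter> V z)" "z \<in> W \<inter> V z" using W VG z by auto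
      ultimately show ?thesis by (simp add: continuous_on_eq_continuous_at)
    qed
    then show "continuous_on W (\<lambda>z. K z z k)"
      by (simp add: continuous_at_imp_continuous_on)
  qed
  then show ?thesis by blast
qed

definition signed_dist :: "'a::metric_space set \<Rightarrow> 'a \<Rightarrow> real" where
  "signed_dist \<Omega> z = (if z \<in> \<Omega> then - infdist z (frontier \<Omega>) else infdist z (frontier \<Omega>))"

lemma abs_signed_dist: "\<bar>signed_dist \<Omega> z\<bar> = infdist z (frontier \<Omega>)"
  by (simp add: signed_dist_def infdist_nonneg)

lemma signed_dist_frontier: "p \<in> frontier \<Omega> \<Longrightarrow> signed_dist \<Omega> p = 0"
  by (simp add: signed_dist_def)

text \<open>The segment crosses the frontier, and the crossing point splits its length. This is the
  case of opposite signs in the Lipschitz bound for the signed distance.\<close>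

lemma infdist_frontier_add_le:
  fixes x y :: "'a::euclidean_space"
  assumes "x \<in> \<Omega>" "y \<notin> \<Omega>"
  shows "infdist x (frontier \<Omega>) + infdist y (frontier \<Omega>) \<le> dist x y"
proof -
  have "closed_segment x y \<inter> frontier \<Omega> \<noteq> {}"
    by (rule connected_Int_frontier) (use assms in auto)
  then obtain m where m: "m \<in> closed_segment x y" "m \<in> frontier \<Omega>" by blast
  have "infdist x (frontier \<Omega>) \<le> dist x m" "infdist y (frontier \<Omega>) \<le> dist y m"
    using m by (auto intro: infdist_le)
  moreover have "dist x m + dist y m = dist x y"
    using m(1) between[of x y m] by (simp add: between_mem_segment dist_commute)
  ultimately show ?thesis by linarith
qed

lemma signed_dist_lipschitz:
  fixes x y :: "'a::euclidean_space"
  shows "\<bar>signed_dist \<Omega> x - signed_dist \<Omega> y\<bar> \<le> dist x y"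
  using infdist_frontier_add_le[of x \<Omega> y] infdist_frontier_add_le[of y \<Omega> x]
    infdist_triangle_abs[of x "frontier \<Omega>" y] infdist_nonneg[of x "frontier \<Omega>"]
    infdist_nonneg[of y "frontier \<Omega>"]
  by (auto simp: signed_dist_def dist_commute)

section \<open>Nearest boundary points and unit normals of a domain with \<open>C\<^sup>2\<close>
  boundary\<close>

locale C2_domain =
  fixes \<Omega> U :: "'a::euclidean_space set" and r N D
  assumes open_dom: "open \<Omega>" and bounded_dom: "bounded \<Omega>" and dom_ne: "\<Omega> \<noteq> {}"
    and U: "open U" "closure \<Omega> \<subseteq> U" and r: "C2_grad U r N D"
    and dom_eq: "\<Omega> = {z\<in>U. r z < 0}" and N_nz: "p \<in> frontier \<Omega> \<Longrightarrow> N p \<noteq> 0"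
begin

lemma frontier_ne: "frontier \<Omega> \<noteq> {}"
  using frontier_eq_empty[of \<Omega>] dom_ne bounded_dom not_bounded_UNIV by auto

lemma frontier_in_U: "p \<in> frontier \<Omega> \<Longrightarrow> p \<in> U"
  using U(2) by (auto simp: frontier_def)

lemma r_frontier:
  assumes "p \<in> frontier \<Omega>"
  shows "r p = 0"
proof (rule antisym)
  have p: "p \<in> closure \<Omega>" "p \<notin> \<Omega>"
    using assms open_dom by (auto simp: frontier_def interior_open)
  have "isCont r p"
    using C2_gradD(1)[OF r frontier_in_U[OF assms]] by (rule has_derivative_continuous)
  show "r p \<le> 0"
  proof (rule ccontr)
    assume "\<not> r p \<le> 0"
    then have "\<forall>\<^sub>F z in nhds p. r z > 0"
      using \<open>isCont r p\<close> order_tendstoD(1)[of r "r p" "at p" 0]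
      by (auto simp: isCont_def eventually_nhds_conv_at)
    then obtain T where "open T" "p \<in> T" "\<forall>z\<in>T. r z > 0" by (auto simp: eventually_nhds)
    moreover from this p have "T \<inter> \<Omega> \<noteq> {}"
      using open_Int_closure_eq_empty[of T \<Omega>] by blast
    ultimately show False using dom_eq by force
  qed
  show "0 \<le> r p" using p(2) frontier_in_U[OF assms] dom_eq by force
qed

definition \<nu> :: "'a \<Rightarrow> 'a" where "\<nu> p = N p /\<^sub>R norm (N p)"

lemma norm_\<nu>: "N p \<noteq> 0 \<Longrightarrow> norm (\<nu> p) = 1"
  by (simp add: \<nu>_def)

lemma nearest_point_exists:
  obtains q where "q \<in> frontier \<Omega>" "dist z q = infdist z (frontier \<Omega>)"
proof -
  obtain q where "q \<in> frontier \<Omega>" "infdist z (frontier \<Omega>) = dist z q"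
    by (rule infdist_attains_inf[OF frontier_closed frontier_ne])
  then show thesis by (intro that[of q]) simp_all
qed

text \<open>The open ball about \<open>z\<close> through its nearest frontier point lies on one side of the frontier, which
  determines both the direction of the segment and the side.\<close>

lemma nearest_point_normal:
  assumes q: "q \<in> frontier \<Omega>" and near: "dist z q = infdist z (frontier \<Omega>)"
  shows "z - q = signed_dist \<Omega> z *\<^sub>R \<nu> q"
proof (cases "z = q")
  case True
  then show ?thesis by (simp add: signed_dist_frontier q)
next
  case False
  define d where "d = dist z q"
  define w where "w = z - q"
  have w: "w \<noteq> 0" "norm w = d" using False by (auto simp: w_def d_def dist_norm)
  have d: "d > 0" using False by (simp add: d_def)
  have "ball z d \<inter> frontier \<Omega> = {}"
    using near infdist_le[of _ "frontier \<Omega>" z] by (force simp: d_def)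
  then have side: "ball z d \<subseteq> \<Omega> \<or> ball z d \<inter> \<Omega> = {}"
    using connected_Int_frontier[of "ball z d" \<Omega>] by auto
  have z: "z \<in> ball z d" using d by simp
  \<comment> \<open>The vector \<open>w\<close> points from q to the center z of the ball, so the
    squared distance to z has derivative -2 (\<open>w \<bullet> v\<close>) at q in direction v; the
    path moves into the ball.\<close>
  have enter: "\<forall>\<^sub>F \<epsilon> in at_right 0. q + \<epsilon> *\<^sub>R v \<in> ball z d \<inter> U" if v: "0 < w \<bullet> v" for v
  proof (rule eventually_conj[of "\<lambda>\<epsilon>. q + \<epsilon> *\<^sub>R v \<in> ball z d" _ "\<lambda>\<epsilon>. q + \<epsilon> *\<^sub>R v \<in> U", unfolded Int_iff[symmetric]])
    have "((\<lambda>x. - (x \<bullet> x)) has_derivative (\<lambda>h. (2 *\<^sub>R w) \<bullet> h)) (at (- w))"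
      by (auto intro!: derivative_eq_intros simp: inner_commute)
    from eventually_less_along_direction[OF this, of v] v
    have "\<forall>\<^sub>F \<epsilon> in at_right 0. (- w + \<epsilon> *\<^sub>R v) \<bullet> (- w + \<epsilon> *\<^sub>R v) < w \<bullet> w" by simp
    then show "\<forall>\<^sub>F \<epsilon> in at_right 0. q + \<epsilon> *\<^sub>R v \<in> ball z d"
    proof (rule eventually_mono)
      fix \<epsilon> assume "(- w + \<epsilon> *\<^sub>R v) \<bullet> (- w + \<epsilon> *\<^sub>R v) < w \<bullet> w"
      then have "norm (- w + \<epsilon> *\<^sub>R v) < norm w"
        by (simp add: norm_lt)
      then show "q + \<epsilon> *\<^sub>R v \<in> ball z d"
        using w(2) by (simp add: mem_ball dist_commute[of z] dist_norm w_def add_diff_eq diff_add_eq norm_minus_commute)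
    qed
    have "((\<lambda>\<epsilon>. q + \<epsilon> *\<^sub>R v) \<longlongrightarrow> q + 0 *\<^sub>R v) (at_right 0)"
      by (intro tendsto_intros)
    then show "\<forall>\<^sub>F \<epsilon> in at_right 0. q + \<epsilon> *\<^sub>R v \<in> U"
      using topological_tendstoD[OF _ U(1)] frontier_in_U[OF q] by simp
  qed
  have dr: "(r has_derivative (\<lambda>h. N q \<bullet> h)) (at q)"
    by (rule C2_gradD(1)[OF r frontier_in_U[OF q]])
  then have dr': "((\<lambda>x. - r x) has_derivative (\<lambda>h. (- N q) \<bullet> h)) (at q)"
    by (auto intro!: derivative_eq_intros)
  have r0: "r q = 0" by (rule r_frontier[OF q])
  have sd: "signed_dist \<Omega> z = (if z \<in> \<Omega> then - d else d)"
    by (simp add: signed_dist_def near d_def)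
  show ?thesis
  proof (cases "z \<in> \<Omega>")
    case True
    with side z have ball: "ball z d \<subseteq> \<Omega>" by blast
    \<comment> \<open>Otherwise q + \<epsilon> v would lie in the ball, hence in the domain, while
      \<open>r\<close> is positive there. So \<open>N q\<close> is a negative multiple of
      \<open>w\<close>; outside the domain the signs are reversed.\<close>
    have "N q \<bullet> v \<le> 0" if v: "0 < w \<bullet> v" for v
    proof (rule ccontr)
      assume "\<not> N q \<bullet> v \<le> 0"
      then have "\<forall>\<^sub>F \<epsilon> in at_right 0. r q < r (q + \<epsilon> *\<^sub>R v)"
        by (intro eventually_less_along_direction[OF dr]) simp
      then have "\<forall>\<^sub>F \<epsilon> in at_right (0::real). False"
        using enter[OF v] by eventually_elim (use ball dom_eq r0 in force)
      then show False by simp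
    qed
    from halfspace_containment[OF w(1) this] obtain k where k: "k \<ge> 0" "N q = - k *\<^sub>R w" by blast
    have "k \<noteq> 0" using N_nz[OF q] k by auto
    then have "\<nu> q = - (1 / d) *\<^sub>R w"
      using k w d by (simp add: \<nu>_def field_simps)
    then show ?thesis using True d by (simp add: sd w_def)
  next
    case False
    with side z have ball: "ball z d \<inter> \<Omega> = {}" by blast
    have "- N q \<bullet> v \<le> 0" if v: "0 < w \<bullet> v" for v
    proof (rule ccontr)
      assume "\<not> - N q \<bullet> v \<le> 0"
      then have "\<forall>\<^sub>F \<epsilon> in at_right 0. - r q < - r (q + \<epsilon> *\<^sub>R v)"
        by (intro eventually_less_along_direction[OF dr']) simp
      then have "\<forall>\<^sub>F \<epsilon> in at_right (0::real). False"
        using enter[OF v] by eventually_elim (use ball dom_eq r0 in force)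
      then show False by simp
    qed
    from halfspace_containment[OF w(1) this] obtain k where k: "k \<ge> 0" "- N q = - k *\<^sub>R w" by blast
    then have N: "N q = k *\<^sub>R w" by simp
    have "k \<noteq> 0" using N_nz[OF q] N by auto
    then have "\<nu> q = (1 / d) *\<^sub>R w"
      using k(1) N w d by (simp add: \<nu>_def field_simps)
    then show ?thesis using False d by (simp add: sd w_def)
  qed
qed

end

text \<open>Beyond the differentiable local inverse, the point is that its derivative is continuous.
  That derivative is the inverse of the derivative of \<open>f\<close> at \<open>g y\<close>, so
  \<open>continuous_on_inv_blinfun\<close> applies along \<open>g\<close>.\<close>

lemma inverse_function_C1:
  fixes f :: "'a::euclidean_space \<Rightarrow> 'a"
  assumes "open U" "x0 \<in> U" and f: "C1_field U f F" and inj: "\<And>h. F x0 h = 0 \<Longrightarrow> h = 0"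
  obtains U' V g G where "open U'" "U' \<subseteq> U" "x0 \<in> U'" "open V" "f x0 \<in> V" "homeomorphism U' V f g"
    "C1_field V g G"
proof -
  from C1_field_blinfun[OF f] obtain F' where F':
    "\<And>z. z \<in> U \<Longrightarrow> blinfun_apply (F' z) = F z" "continuous_on U F'" by blast
  have lin: "linear (blinfun_apply (F' x0))"
    by (simp add: blinfun.bounded_linear_right bounded_linear.linear)
  moreover have "inj (blinfun_apply (F' x0))"
    using lin inj assms(2) by (simp add: linear_injective_0 F'(1))
  ultimately obtain k where k: "linear k" "\<And>x. k (F' x0 x) = x"
    using linear_injective_isomorphism[of "blinfun_apply (F' x0)"] by blast
  have bk: "bounded_linear k" using k(1) by (simp add: linear_conv_bounded_linear)
  have inv: "Blinfun k o\<^sub>L F' x0 = id_blinfun"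
    by (rule blinfun_eqI) (simp add: bounded_linear_Blinfun_apply[OF bk] k)
  have der: "(f has_derivative blinfun_apply (F' x)) (at x)" if "x \<in> U" for x
    using f that by (simp add: C1_field_def F'(1))
  obtain U' V g G where g: "open U'" "U' \<subseteq> U" "x0 \<in> U'" "open V" "f x0 \<in> V" "homeomorphism U' V f g"
    "\<And>y. y \<in> V \<Longrightarrow> (g has_derivative (G y)) (at y)"
    "\<And>y. y \<in> V \<Longrightarrow> G y = inv (blinfun_apply (F' (g y)))"
    "\<And>y. y \<in> V \<Longrightarrow> bij (blinfun_apply (F' (g y)))"
  proof (rule inverse_function_theorem[OF assms(1) der F'(2) assms(2) inv], goal_cases)
    case (2 U' V g G)
    from 2(2-) show ?case by (rule 2(1))
  qed
  have gV: "g ` V \<subseteq> U" using g(2,6) by (auto simp: homeomorphism_def)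
  have "continuous_on V (\<lambda>y. F' (g y))"
    using g(6) gV by (intro continuous_on_compose2[OF F'(2)]) (auto simp: homeomorphism_def)
  note * = continuous_on_inv_blinfun[OF this g(9)]
  have "continuous_on V (\<lambda>y. G y h)" for h
    by (rule continuous_on_eq[OF *[of h]]) (simp_all add: g(8))
  then have "C1_field V g G" using g(7) by (simp add: C1_field_def)
  with g show thesis by (intro that)
qed

context C2_domain
begin

text \<open>The quotient rule for \<open>\<nu>\<close>: the second term removes the component of the
  first one along \<open>N q\<close>, as it must for a field of unit vectors.\<close>

definition \<nu>' :: "'a \<Rightarrow> 'a \<Rightarrow> 'a" where
  "\<nu>' q h = D q h /\<^sub>R norm (N q) - ((N q \<bullet> D q h) / norm (N q) ^ 3) *\<^sub>R N q"

lemma \<nu>_C1: "C1_field {q\<in>U. N q \<noteq> 0} \<nu> \<nu>'"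
  unfolding C1_field_def
proof (intro conjI ballI allI)
  fix q assume "q \<in> {q\<in>U. N q \<noteq> 0}"
  then have q: "q \<in> U" "N q \<noteq> 0" by auto
  have 1: "((\<lambda>q. norm (N q)) has_derivative (\<lambda>h. (N q \<bullet> D q h) / norm (N q))) (at q)"
    using has_derivative_compose[OF C2_gradD(2)[OF r q(1)] has_derivative_norm[OF q(2)]]
    by (simp add: sgn_div_norm inner_commute divide_inverse mult.commute)
  show "(\<nu> has_derivative \<nu>' q) (at q)"
    unfolding \<nu>_def[abs_def] \<nu>'_def[abs_def]
    by (rule has_derivative_eq_rhs[OF
          has_derivative_scaleR[OF Deriv.has_derivative_inverse[OF _ 1] C2_gradD(2)[OF r q(1)]]])
      (use q in \<open>auto simp: fun_eq_iff power3_eq_cube divide_inverse algebra_simps\<close>)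
next
  fix h
  have [continuous_intros]: "continuous_on {q\<in>U. N q \<noteq> 0} N" "continuous_on {q\<in>U. N q \<noteq> 0} (\<lambda>q. D q h)"
    using C2_grad_continuous(2)[OF r] C2_gradD(3)[OF r, of h] by (auto elim: continuous_on_subset)
  show "continuous_on {q\<in>U. N q \<noteq> 0} (\<lambda>q. \<nu>' q h)"
    unfolding \<nu>'_def by (intro continuous_intros) auto
qed

lemma \<nu>_orth: "N q \<noteq> 0 \<Longrightarrow> \<nu> q \<bullet> \<nu>' q h = 0"
  by (simp add: \<nu>_def \<nu>'_def inner_diff_right power3_eq_cube power2_norm_eq_inner[symmetric] power2_eq_square field_simps)

text \<open>The inverse function theorem for \<open>(x, t) \<mapsto> (x + t N x, r x)\<close> makes the nearest point \<open>x(z)\<close> a \<open>C\<^sup>1\<close>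
  function. Differentiating \<open>(z - x(z)) \<bullet> \<nu>(x(z))\<close>, all terms but \<open>\<nu>(x(z))\<close> cancel, so the gradient is again \<open>C\<^sup>1\<close>.\<close>

lemma signed_dist_locally_C2:
  assumes p: "p \<in> frontier \<Omega>"
  shows "\<exists>V g H. open V \<and> p \<in> V \<and> C2_grad V (signed_dist \<Omega>) g H \<and> g p = \<nu> p"
proof -
  have pU: "p \<in> U" and Np: "N p \<noteq> 0" using p frontier_in_U N_nz by auto
  define G where "G = (\<lambda>(x, t). (x + t *\<^sub>R N x, r x))"
  define G' where "G' = (\<lambda>(x, t) (h, s). (h + (s *\<^sub>R N x + t *\<^sub>R D x h), N x \<bullet> h))"
  have G: "C1_field (U \<times> UNIV) G G'"
    unfolding C1_field_def
  proof (intro conjI ballI allI)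
    fix y :: "'a \<times> real" assume "y \<in> U \<times> UNIV"
    then have y: "fst y \<in> U" by auto
    have N: "((\<lambda>w. N (fst w)) has_derivative (\<lambda>k. D (fst y) (fst k))) (at y)"
      by (rule has_derivative_compose[OF has_derivative_fst[OF has_derivative_ident] C2_gradD(2)[OF r y]])
    have R: "((\<lambda>w. r (fst w)) has_derivative (\<lambda>k. N (fst y) \<bullet> fst k)) (at y)"
      by (rule has_derivative_compose[OF has_derivative_fst[OF has_derivative_ident] C2_gradD(1)[OF r y]])
    show "(G has_derivative G' y) (at y)"
      unfolding G_def split_def
      by (rule has_derivative_eq_rhs[OF has_derivative_Pair[OF
            has_derivative_add[OF has_derivative_fst[OF has_derivative_ident]
              has_derivative_scaleR[OF has_derivative_snd[OF has_derivative_ident] N]] R]])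
        (auto simp: G'_def split_def fun_eq_iff)
  next
    fix k :: "'a \<times> real"
    have [continuous_intros]: "continuous_on (U \<times> UNIV) (\<lambda>w :: 'a \<times> real. N (fst w))"
      "continuous_on (U \<times> UNIV) (\<lambda>w :: 'a \<times> real. D (fst w) (fst k))"
      by (auto intro!: continuous_on_compose2[OF C2_grad_continuous(2)[OF r]]
          continuous_on_compose2[OF C2_gradD(3)[OF r]] continuous_intros)
    show "continuous_on (U \<times> UNIV) (\<lambda>y. G' y k)"
      unfolding G'_def split_def by (intro continuous_intros)
  qed
  have inj: "k = 0" if "G' (p, 0) k = 0" for k
  proof -
    obtain h s where k: "k = (h, s)" by force
    have "h = - s *\<^sub>R N p" "N p \<bullet> h = 0"
      using that k by (auto simp: G'_def zero_prod_def eq_neg_iff_add_eq_0)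
    then show ?thesis using Np k by (auto simp: zero_prod_def)
  qed
  have "open (U \<times> (UNIV :: real set))" "(p, 0) \<in> U \<times> (UNIV :: real set)"
    using U pU by (auto intro: open_Times)
  from inverse_function_C1[OF this G inj] obtain T V \<Gamma> \<Gamma>' where
    T: "open T" "T \<subseteq> U \<times> UNIV" "(p, 0) \<in> T" and V: "open V" "G (p, 0) \<in> V"
    and hom: "homeomorphism T V G \<Gamma>" and \<Gamma>: "C1_field V \<Gamma> \<Gamma>'" by blast
  from T(1,3) obtain A B where AB: "open A" "open B" "p \<in> A" "0 \<in> B" "A \<times> B \<subseteq> T"
    by (metis open_prod_elim mem_Sigma_iff)
  obtain a where a: "a > 0" "ball p a \<subseteq> A" by (rule openE[OF AB(1,3)])
  obtain b where b: "b > 0" "ball 0 b \<subseteq> B" by (rule openE[OF AB(2,4)])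
  have "isCont N p" using C2_gradD(2)[OF r pU] by (rule has_derivative_continuous)
  then obtain c where c: "c > 0" "\<And>q. dist q p < c \<Longrightarrow> dist (N q) (N p) < norm (N p) / 2"
    using Np unfolding continuous_at_eps_delta by (metis half_gt_zero zero_less_norm_iff)
  have "open ((\<lambda>z. (z, 0::real)) -` V)"
    by (intro open_vimage V(1) continuous_intros)
  moreover have "p \<in> (\<lambda>z. (z, 0::real)) -` V"
    using V(2) r_frontier[OF p] by (simp add: G_def)
  ultimately obtain e where "e > 0" "ball p e \<subseteq> (\<lambda>z. (z, 0::real)) -` V"
    by (rule openE)
  then have e: "e > 0" "\<And>z. z \<in> ball p e \<Longrightarrow> (z, 0) \<in> V" by auto
  \<comment> \<open>For z within \<delta> of p every nearest point q is within 2 \<delta> of p. The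
    bounds by a / 2 and c / 2 then put q into \<open>A\<close> and give |N q| > |N p| / 2, and the
    last bound makes |s| < b for the parameter s =
    \<open>signed_dist \<Omega> z / norm (N q)\<close>.\<close>
  define \<delta> where "\<delta> = min e (min (a / 2) (min (c / 2) (b * norm (N p) / 2)))"
  have \<delta>: "\<delta> > 0" using e a c b Np by (simp add: \<delta>_def)
  define W where "W = ball p \<delta>"
  define x where "x z = fst (\<Gamma> (z, 0))" for z
  define x' where "x' z h = fst (\<Gamma>' (z, 0) (h, 0))" for z h
  \<comment> \<open>A nearest point q together with its parameter s lies in \<open>T\<close> and is
    mapped by \<open>G\<close> to (z, 0). Injectivity of \<open>G\<close> on \<open>T\<close> then
    identifies q with \<open>x z\<close>, so the nearest point is also unique.\<close>
  have xq: "x z \<in> frontier \<Omega> \<and> dist z (x z) = infdist z (frontier \<Omega>)" if z: "z \<in> W" for z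
  proof -
    obtain q where q: "q \<in> frontier \<Omega>" "dist z q = infdist z (frontier \<Omega>)"
      by (rule nearest_point_exists)
    have zp: "dist z p < \<delta>" using z by (simp add: W_def dist_commute)
    have zq: "dist z q \<le> dist z p" using q(2) infdist_le[OF p, of z] by simp
    have qp: "dist q p < 2 * \<delta>" using zp zq dist_triangle[of q p z] by (simp add: dist_commute)
    have "dist (N q) (N p) < norm (N p) / 2" using c(2)[of q] qp by (simp add: \<delta>_def)
    then have Nq: "norm (N p) / 2 < norm (N q)"
      using norm_triangle_ineq2[of "N p" "N q"] by (simp add: dist_norm norm_minus_commute)
    define s where "s = signed_dist \<Omega> z / norm (N q)"
    have "\<bar>signed_dist \<Omega> z\<bar> < b * norm (N p) / 2"
      using zq zp q(2) by (simp add: abs_signed_dist \<delta>_def)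
    also have "\<dots> < b * norm (N q)" using mult_strict_left_mono[OF Nq b(1)] by simp
    finally have "\<bar>s\<bar> < b" using Np Nq using b(1) by (simp add: s_def abs_divide divide_less_eq)
    then have "s \<in> B" using b(2) by (auto simp: dist_real_def)
    moreover have "q \<in> A" using qp a(2) by (auto simp: \<delta>_def dist_commute)
    ultimately have qs: "(q, s) \<in> T" using AB(5) by blast
    have "q + s *\<^sub>R N q = z"
      using nearest_point_normal[OF q] by (simp add: s_def \<nu>_def divide_inverse algebra_simps)
    then have "G (q, s) = (z, 0)" using r_frontier[OF q(1)] by (simp add: G_def)
    then have "\<Gamma> (z, 0) = (q, s)" using homeomorphism_apply1[OF hom qs] by simp
    then show ?thesis using q by (simp add: x_def)
  qed
  have WV: "(z, 0) \<in> V" if "z \<in> W" for z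
    using that e(2) by (simp add: W_def \<delta>_def)
  have xU: "x z \<in> {q\<in>U. N q \<noteq> 0}" if "z \<in> W" for z
    using xq[OF that] frontier_in_U N_nz by blast
  have dx: "(x has_derivative x' z) (at z)" if "z \<in> W" for z
  proof -
    have "((\<lambda>z. (z, 0::real)) has_derivative (\<lambda>h. (h, 0))) (at z)"
      by (auto intro!: derivative_eq_intros)
    from has_derivative_compose[OF this, of \<Gamma> "\<Gamma>' (z, 0)"] \<Gamma> WV[OF that]
    have "((\<lambda>z. \<Gamma> (z, 0)) has_derivative (\<lambda>h. \<Gamma>' (z, 0) (h, 0))) (at z)"
      by (simp add: C1_field_def)
    then show ?thesis unfolding x_def x'_def by (rule has_derivative_fst)
  qed
  have contx: "continuous_on W x"
    using has_derivative_continuous[OF dx] by (simp add: continuous_at_imp_continuous_on)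
  have contx': "continuous_on W (\<lambda>z. x' z h)" for h
  proof -
    have "continuous_on V (\<lambda>y. \<Gamma>' y (h, 0))" using \<Gamma> by (simp add: C1_field_def)
    then have "continuous_on W (\<lambda>z. \<Gamma>' (z, 0) (h, 0))"
      by (rule continuous_on_compose2) (use WV in \<open>auto intro!: continuous_intros\<close>)
    then show ?thesis unfolding x'_def by (intro continuous_intros)
  qed
  have oW: "open W" by (simp add: W_def)
  \<comment> \<open>The image of \<open>x\<close> lies in the frontier, so \<open>r\<close> is
    constant along \<open>x\<close> and the derivative of \<open>x\<close> is tangential.\<close>
  have tang: "N (x z) \<bullet> x' z h = 0" if z: "z \<in> W" for z h
  proof -
    have "((\<lambda>z. r (x z)) has_derivative (\<lambda>h. N (x z) \<bullet> x' z h)) (at z)"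
      using has_derivative_compose[OF dx[OF z], of r "\<lambda>h. N (x z) \<bullet> h"] C2_gradD(1)[OF r] xU[OF z] by simp
    moreover have "((\<lambda>z. r (x z)) has_derivative (\<lambda>h. 0)) (at z)"
      by (rule has_derivative_transform_within_open[OF has_derivative_const[of 0] oW z])
        (use xq r_frontier in auto)
    ultimately have "(\<lambda>h. N (x z) \<bullet> x' z h) = (\<lambda>h. 0)"
      by (rule has_derivative_unique)
    then show ?thesis by (rule fun_cong)
  qed
  have d\<nu>: "((\<lambda>z. \<nu> (x z)) has_derivative (\<lambda>h. \<nu>' (x z) (x' z h))) (at z)" if z: "z \<in> W" for z
    using has_derivative_compose[OF dx[OF z], of \<nu> "\<nu>' (x z)"] \<nu>_C1 xU[OF z] by (simp add: C1_field_def)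
  have sd_eq: "(z - x z) \<bullet> \<nu> (x z) = signed_dist \<Omega> z" if "z \<in> W" for z
    using nearest_point_normal[of "x z" z] xq[OF that] norm_\<nu>[of "x z"] xU[OF that]
    by (simp add: norm_eq_1)
  from C1_field_blinfun[OF \<nu>_C1] obtain K where K:
    "\<And>q. q \<in> {q\<in>U. N q \<noteq> 0} \<Longrightarrow> blinfun_apply (K q) = \<nu>' q" "continuous_on {q\<in>U. N q \<noteq> 0} K"
    by blast
  have "C2_grad W (signed_dist \<Omega>) (\<lambda>z. \<nu> (x z)) (\<lambda>z h. \<nu>' (x z) (x' z h))"
  proof (rule C2_gradI)
    fix z assume z: "z \<in> W"
    have "((\<lambda>z. (z - x z) \<bullet> \<nu> (x z)) has_derivative
      (\<lambda>h. (z - x z) \<bullet> \<nu>' (x z) (x' z h) + (h - x' z h) \<bullet> \<nu> (x z))) (at z)"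
      by (intro has_derivative_inner has_derivative_diff has_derivative_ident dx[OF z] d\<nu>[OF z])
    moreover have "(z - x z) \<bullet> \<nu>' (x z) (x' z h) + (h - x' z h) \<bullet> \<nu> (x z) = \<nu> (x z) \<bullet> h" for h
    proof -
      have "(z - x z) \<bullet> \<nu>' (x z) (x' z h) = 0"
        using nearest_point_normal[of "x z" z] xq[OF z] \<nu>_orth[of "x z"] xU[OF z] by simp
      moreover have "\<nu> (x z) \<bullet> x' z h = 0"
        using tang[OF z, of h] by (simp add: \<nu>_def)
      ultimately show ?thesis by (simp add: inner_diff_right inner_commute[of _ "\<nu> (x z)"])
    qed
    ultimately have "((\<lambda>z. (z - x z) \<bullet> \<nu> (x z)) has_derivative (\<lambda>h. \<nu> (x z) \<bullet> h)) (at z)"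
      by simp
    then show "(signed_dist \<Omega> has_derivative (\<bullet>) (\<nu> (x z))) (at z)"
      by (rule has_derivative_transform_within_open[OF _ oW z]) (rule sd_eq)
    show "((\<lambda>z. \<nu> (x z)) has_derivative (\<lambda>h. \<nu>' (x z) (x' z h))) (at z)"
      by (rule d\<nu>[OF z])
  next
    fix h
    have "continuous_on W (\<lambda>z. K (x z))"
      by (rule continuous_on_compose2[OF K(2) contx]) (use xU in auto)
    then have "continuous_on W (\<lambda>z. K (x z) (x' z h))"
      by (intro continuous_intros contx')
    then show "continuous_on W (\<lambda>z. \<nu>' (x z) (x' z h))"
      by (rule continuous_on_eq) (simp add: K(1)[OF xU])
  qed
  moreover have "p \<in> W" using \<delta> by (simp add: W_def)
  moreover have "x p = p"
    using xq[OF \<open>p \<in> W\<close>] p by simp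
  ultimately show ?thesis using oW
    by (intro exI[of _ W] exI[of _ "\<lambda>z. \<nu> (x z)"] exI[of _ "\<lambda>z h. \<nu>' (x z) (x' z h)"]) simp
qed

lemma signed_dist_C2:
  obtains \<epsilon> g H where "\<epsilon> > 0" "C2_grad {z. infdist z (frontier \<Omega>) < \<epsilon>} (signed_dist \<Omega>) g H"
    "\<And>p. p \<in> frontier \<Omega> \<Longrightarrow> g p = \<nu> p"
proof -
  from signed_dist_locally_C2 obtain V G K where V:
    "\<And>p. p \<in> frontier \<Omega> \<Longrightarrow> open (V p) \<and> p \<in> V p \<and> C2_grad (V p) (signed_dist \<Omega>) (G p) (K p) \<and> G p p = \<nu> p"
    by metis
  define W where "W = (\<Union>p\<in>frontier \<Omega>. V p)"
  have "open W" using V by (auto simp: W_def)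
  have cF: "compact (frontier \<Omega>)" using bounded_dom by (rule compact_frontier_bounded)
  have sub: "frontier \<Omega> \<subseteq> W" using V by (auto simp: W_def)
  obtain \<epsilon> where \<epsilon>: "\<epsilon> > 0" "{x. infdist x (frontier \<Omega>) \<le> \<epsilon>} \<subseteq> W"
    by (rule compact_in_open_separated[OF frontier_ne cF \<open>open W\<close> sub])
  have "\<exists>g H. C2_grad W (signed_dist \<Omega>) g H"
    by (rule C2_grad_local[OF \<open>open W\<close>]) (use V in \<open>auto simp: W_def\<close>)
  then obtain g H where gH: "C2_grad W (signed_dist \<Omega>) g H" by blast
  show thesis
  proof (rule that[OF \<epsilon>(1)])
    show "C2_grad {z. infdist z (frontier \<Omega>) < \<epsilon>} (signed_dist \<Omega>) g H"
      by (rule C2_grad_subset[OF gH]) (use \<epsilon>(2) in auto)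
    fix p assume p: "p \<in> frontier \<Omega>"
    have "g p = G p p"
      by (rule has_gradient_unique[OF C2_gradD(1)[OF gH] C2_gradD(1)[of "V p" _ "G p" "K p"]])
        (use sub V p in auto)
    then show "g p = \<nu> p" using V p by simp
  qed
qed

end

subsection \<open>Comparison of Hessians\<close>

lemma C2_grad_uminus: "C2_grad V u g H \<Longrightarrow> C2_grad V (\<lambda>z. - u z) (\<lambda>z. - g z) (\<lambda>z h. - H z h)"
  by (auto simp: C2_grad_def C1_field_def intro!: derivative_eq_intros continuous_intros)

lemma C2_grad_translate:
  assumes "C2_grad V u g H"
  shows "C2_grad {y. a + y \<in> V} (\<lambda>y. u (a + y)) (\<lambda>y. g (a + y)) (\<lambda>y. H (a + y))"
proof (rule C2_gradI)
  fix y assume y: "y \<in> {y. a + y \<in> V}"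
  have t: "((\<lambda>y. a + y) has_derivative (\<lambda>h. h)) (at y)" by (auto intro!: derivative_eq_intros)
  show "((\<lambda>y. u (a + y)) has_derivative (\<bullet>) (g (a + y))) (at y)"
    using has_derivative_compose[OF t C2_gradD(1)[OF assms]] y by simp
  show "((\<lambda>y. g (a + y)) has_derivative H (a + y)) (at y)"
    using has_derivative_compose[OF t C2_gradD(2)[OF assms]] y by simp
next
  fix h
  show "continuous_on {y. a + y \<in> V} (\<lambda>y. H (a + y) h)"
    by (rule continuous_on_compose2[OF C2_gradD(3)[OF assms]]) (auto intro!: continuous_intros)
qed

lemma C2_grad_diff:
  assumes "C2_grad V u g H" "C2_grad V u' g' H'"
  shows "C2_grad V (\<lambda>z. u z - u' z) (\<lambda>z. g z - g' z) (\<lambda>z h. H z h - H' z h)"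
  using assms
  by (auto simp: C2_grad_def C1_field_def inner_diff_left intro!: derivative_eq_intros continuous_intros)

text \<open>Along the parabola the first derivative of \<open>u\<close> at t = 0 is
  \<open>g p \<bullet> v\<close> = 0, and the assumed negative number is the second derivative. The
  bend \<open>a\<close> enters at second order only through the gradient.\<close>

lemma parabola_decreasing:
  fixes u :: "'a::euclidean_space \<Rightarrow> real"
  assumes V: "open V" "p \<in> V" and u: "C2_grad V u g H"
    and crit: "g p \<bullet> v = 0" and neg: "H p v \<bullet> v + 2 * a * (g p \<bullet> w) < 0"
  shows "\<forall>\<^sub>F t in at_right 0. u (p + t *\<^sub>R v + (a * t\<^sup>2) *\<^sub>R w) < u p"
proof -
  define \<gamma> where "\<gamma> t = p + t *\<^sub>R v + (a * t\<^sup>2) *\<^sub>R w" for t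
  define \<phi>' where "\<phi>' t = g (\<gamma> t) \<bullet> (v + (2 * a * t) *\<^sub>R w)" for t
  have d\<gamma>: "(\<gamma> has_derivative (\<lambda>s. s *\<^sub>R (v + (2 * a * t) *\<^sub>R w))) (at t)" for t
    unfolding \<gamma>_def by (auto intro!: derivative_eq_intros simp: fun_eq_iff algebra_simps)
  have \<gamma>0: "\<gamma> 0 = p" by (simp add: \<gamma>_def)
  have "isCont \<gamma> 0" using d\<gamma> by (rule has_derivative_continuous)
  then have "\<forall>\<^sub>F t in at 0. \<gamma> t \<in> V"
    using V \<gamma>0 by (auto simp: isCont_def dest: topological_tendstoD)
  then obtain e where e: "e > 0" "\<And>t. \<bar>t\<bar> < e \<Longrightarrow> \<gamma> t \<in> V"
    using \<gamma>0 V(2) unfolding eventually_at by (auto simp: dist_real_def) metis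
  have du: "((\<lambda>t. u (\<gamma> t)) has_real_derivative \<phi>' t) (at t)" if "\<bar>t\<bar> < e" for t
  proof -
    have "((\<lambda>t. u (\<gamma> t)) has_derivative (\<lambda>s. g (\<gamma> t) \<bullet> (s *\<^sub>R (v + (2 * a * t) *\<^sub>R w)))) (at t)"
      by (rule has_derivative_compose[OF d\<gamma> C2_gradD(1)[OF u e(2)[OF that]]])
    then show ?thesis
      unfolding has_field_derivative_def by (rule has_derivative_eq_rhs) (simp add: \<phi>'_def fun_eq_iff)
  qed
  have "((\<lambda>t. g (\<gamma> t)) has_derivative (\<lambda>s. H p (s *\<^sub>R v))) (at 0)"
    using has_derivative_compose[OF d\<gamma>[of 0], of g "H (\<gamma> 0)"] C2_gradD(2)[OF u V(2)] by (simp add: \<gamma>0)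
  moreover have "((\<lambda>t. v + (2 * a * t) *\<^sub>R w) has_derivative (\<lambda>s. (2 * a * s) *\<^sub>R w)) (at 0)"
    by (auto intro!: derivative_eq_intros)
  ultimately have "(\<phi>' has_derivative
      (\<lambda>s. g (\<gamma> 0) \<bullet> ((2 * a * s) *\<^sub>R w) + H p (s *\<^sub>R v) \<bullet> (v + (2 * a * 0) *\<^sub>R w))) (at 0)"
    unfolding \<phi>'_def by (rule has_derivative_inner)
  then have "(\<phi>' has_real_derivative (H p v \<bullet> v + 2 * a * (g p \<bullet> w))) (at 0)"
    unfolding has_field_derivative_def
    by (rule has_derivative_eq_rhs)
      (simp add: \<gamma>0 fun_eq_iff linear_cmul[OF C2_grad_linear[OF u V(2)]] algebra_simps)
  from has_real_derivative_neg_dec_right[OF this neg] obtain d where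
    d: "d > 0" "\<And>h. 0 < h \<Longrightarrow> h < d \<Longrightarrow> \<phi>' h < \<phi>' 0"
    by auto
  have \<phi>'0: "\<phi>' 0 = 0" using crit by (simp add: \<phi>'_def \<gamma>0)
  have "u (\<gamma> t) < u p" if t: "0 < t" "t < min e d" for t
  proof -
    have "\<exists>s. 0 < s \<and> s < t \<and> u (\<gamma> t) - u (\<gamma> 0) = (t - 0) * \<phi>' s"
      by (rule MVT2) (use t du in auto)
    then obtain s where s: "0 < s" "s < t" "u (\<gamma> t) - u (\<gamma> 0) = t * \<phi>' s" by auto
    have "\<phi>' s < 0" using d(2)[of s] s t \<phi>'0 by simp
    then have "t * \<phi>' s < 0" using t by (simp add: mult_pos_neg)
    then show ?thesis using s(3) \<gamma>0 by simp
  qed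
  then show ?thesis
    unfolding eventually_at_right_field \<gamma>_def using e(1) d(1)
    by (intro exI[of _ "min e d"]) auto
qed

lemma hessian_compare_translate:
  fixes u :: "'a::euclidean_space \<Rightarrow> real"
  assumes V: "open V" "p \<in> V" "z \<in> V" and u: "C2_grad V u g H"
    and le: "\<And>h. u (p + h) - u (z + h) \<le> u p - u z"
  shows "g z = g p" "H p h \<bullet> h \<le> H z h \<bullet> h"
proof -
  define V' where "V' = {y. z + y \<in> V} \<inter> {y. p + y \<in> V}"
  have op: "open {y. b + y \<in> V}" for b
    using open_vimage[OF V(1), of "\<lambda>y. b + y"] by (simp add: vimage_def continuous_intros)
  have V': "open V'" "0 \<in> V'" using V op by (auto simp: V'_def)
  define \<phi> where "\<phi> y = u (z + y) - u (p + y)" for y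
  have \<phi>: "C2_grad V' \<phi> (\<lambda>y. g (z + y) - g (p + y)) (\<lambda>y h. H (z + y) h - H (p + y) h)"
    unfolding \<phi>_def V'_def
    by (intro C2_grad_diff C2_grad_subset[OF C2_grad_translate[OF u]]) auto
  have min: "\<phi> 0 \<le> \<phi> y" for y using le[of y] by (simp add: \<phi>_def)
  have "(\<phi> has_derivative (\<lambda>h. (g z - g p) \<bullet> h)) (at 0)"
    using C2_gradD(1)[OF \<phi> V'(2)] by simp
  then have "(\<lambda>h. (g z - g p) \<bullet> h) = (\<lambda>h. 0)"
    by (rule has_derivative_local_min) (simp add: min)
  then have "(g z - g p) \<bullet> (g z - g p) = 0" by (rule fun_cong)
  then show gg: "g z = g p" by simp
  show "H p h \<bullet> h \<le> H z h \<bullet> h"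
  proof (rule ccontr)
    assume "\<not> H p h \<bullet> h \<le> H z h \<bullet> h"
    \<comment> \<open>With bend 0 the parabola is a straight line, and this is the usual second
      order condition at a minimum.\<close>
    then have "\<forall>\<^sub>F t in at_right 0. \<phi> (0 + t *\<^sub>R h + (0 * t\<^sup>2) *\<^sub>R 0) < \<phi> 0"
      by (intro parabola_decreasing[OF V' \<phi>]) (auto simp: gg inner_diff_left)
    then have "\<forall>\<^sub>F t in at_right (0::real). False"
      by (rule eventually_mono) (use min in \<open>simp add: not_less[symmetric]\<close>)
    then show False by simp
  qed
qed

text \<open>If \<open>f\<close> and \<open>k\<close> define the same domain near \<open>p\<close>, this holds in both directions: the normalized
  Hessian on tangent vectors does not depend on the defining function. The proof tests with parabolas \<open>p + t v + a t\<^sup>2 w\<close>.\<close>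

lemma hessian_compare_sublevel:
  fixes f k :: "'a::euclidean_space \<Rightarrow> real"
  assumes V: "open V" "p \<in> V" and f: "C2_grad V f gf Hf" and k: "C2_grad V k gk Hk"
    and zero: "f p = 0" "k p = 0" and sub: "\<And>z. z \<in> V \<Longrightarrow> f z < 0 \<Longrightarrow> k z < 0"
    and tang: "gf p \<bullet> v = 0" "gk p \<bullet> v = 0" and pos: "0 < gf p \<bullet> w" "0 < gk p \<bullet> w"
  shows "(Hk p v \<bullet> v) / (gk p \<bullet> w) \<le> (Hf p v \<bullet> v) / (gf p \<bullet> w)"
proof -
  \<comment> \<open>The bound on \<open>a\<close> in the assumption is the threshold below which the
    parabola starts into {f < 0}; above the corresponding threshold of \<open>k\<close> it starts
    into {k > 0}. The inclusion of the sublevel sets orders the two thresholds.\<close>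
  have "a \<le> - (Hk p v \<bullet> v) / (2 * (gk p \<bullet> w))" if a: "a < - (Hf p v \<bullet> v) / (2 * (gf p \<bullet> w))" for a
  proof (rule ccontr)
    assume "\<not> ?thesis"
    then have "- Hk p v \<bullet> v + 2 * a * (- gk p \<bullet> w) < 0"
      using pos by (simp add: field_simps)
    from parabola_decreasing[OF V C2_grad_uminus[OF k] _ this] tang
    have 1: "\<forall>\<^sub>F t in at_right 0. 0 < k (p + t *\<^sub>R v + (a * t\<^sup>2) *\<^sub>R w)"
      by (simp add: zero)
    have "Hf p v \<bullet> v + 2 * a * (gf p \<bullet> w) < 0"
      using a pos by (simp add: field_simps)
    from parabola_decreasing[OF V f tang(1) this]
    have 2: "\<forall>\<^sub>F t in at_right 0. f (p + t *\<^sub>R v + (a * t\<^sup>2) *\<^sub>R w) < 0"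
      by (simp add: zero)
    have "((\<lambda>t. p + t *\<^sub>R v + (a * t\<^sup>2) *\<^sub>R w) \<longlongrightarrow> p + 0 *\<^sub>R v + (a * 0\<^sup>2) *\<^sub>R w) (at_right 0)"
      by (intro tendsto_intros)
    then have "\<forall>\<^sub>F t in at_right 0. p + t *\<^sub>R v + (a * t\<^sup>2) *\<^sub>R w \<in> V"
      using topological_tendstoD[OF _ V(1)] V(2) by simp
    with 1 2 have "\<forall>\<^sub>F t in at_right (0::real). False"
      by eventually_elim (use sub in fastforce)
    then show False by simp
  qed
  then have "- (Hf p v \<bullet> v) / (2 * (gf p \<bullet> w)) \<le> - (Hk p v \<bullet> v) / (2 * (gk p \<bullet> w))"
    by (rule dense_le)
  then show ?thesis using pos by (simp add: field_simps)
qed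

lemma C2_grad_compose:
  fixes u :: "'a::euclidean_space \<Rightarrow> real"
  assumes u: "C2_grad V u g H"
    and \<phi>: "\<And>z. z \<in> V \<Longrightarrow> (\<phi> has_real_derivative \<phi>' (u z)) (at (u z))"
    and \<phi>': "\<And>z. z \<in> V \<Longrightarrow> (\<phi>' has_real_derivative \<phi>'' (u z)) (at (u z))"
    and \<phi>'': "continuous_on (u ` V) \<phi>''"
  shows "C2_grad V (\<lambda>z. \<phi> (u z)) (\<lambda>z. \<phi>' (u z) *\<^sub>R g z)
    (\<lambda>z h. \<phi>' (u z) *\<^sub>R H z h + (\<phi>'' (u z) * (g z \<bullet> h)) *\<^sub>R g z)"
proof (rule C2_gradI)
  fix z assume z: "z \<in> V"
  note du = C2_gradD(1)[OF u z]
  show "((\<lambda>z. \<phi> (u z)) has_derivative (\<bullet>) (\<phi>' (u z) *\<^sub>R g z)) (at z)"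
    by (rule has_derivative_eq_rhs[OF has_derivative_compose[OF du \<phi>[OF z, unfolded has_field_derivative_def]]])
      (simp add: fun_eq_iff)
  have "((\<lambda>z. \<phi>' (u z)) has_derivative (\<lambda>h. \<phi>'' (u z) * (g z \<bullet> h))) (at z)"
    by (rule has_derivative_compose[OF du \<phi>'[OF z, unfolded has_field_derivative_def]])
  from has_derivative_scaleR[OF this C2_gradD(2)[OF u z]]
  show "((\<lambda>z. \<phi>' (u z) *\<^sub>R g z) has_derivative
      (\<lambda>h. \<phi>' (u z) *\<^sub>R H z h + (\<phi>'' (u z) * (g z \<bullet> h)) *\<^sub>R g z)) (at z)" .
next
  fix h
  have "continuous_on (u ` V) \<phi>'"
    using \<phi>' by (auto intro!: continuous_at_imp_continuous_on DERIV_isCont)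
  note [continuous_intros] = continuous_on_compose2[OF this C2_grad_continuous(1)[OF u] subset_refl]
    continuous_on_compose2[OF \<phi>'' C2_grad_continuous(1)[OF u] subset_refl]
    C2_grad_continuous(2)[OF u] C2_gradD(3)[OF u]
  show "continuous_on V (\<lambda>z. \<phi>' (u z) *\<^sub>R H z h + (\<phi>'' (u z) * (g z \<bullet> h)) *\<^sub>R g z)"
    by (intro continuous_intros)
qed

subsection \<open>The Levi form of the signed distance\<close>

lemma inner_vec_i [simp]:
  fixes x y :: "complex^'n"
  shows "(\<i> *s x) \<bullet> (\<i> *s y) = x \<bullet> y" "x \<bullet> (\<i> *s x) = 0" "(\<i> *s x) \<bullet> x = 0"
    "\<i> *s (\<i> *s x) = - x" "norm (\<i> *s x) = norm x"
  by (simp_all add: inner_vec_def inner_complex_def norm_vector_scalar_mult algebra_simps vec_eq_iff mult.assoc[symmetric])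

text \<open>Split \<open>\<xi>\<close> into a part \<open>\<sigma>\<close> in the complex line of
  \<open>n\<close> and a complex tangential part \<open>\<tau>\<close>. The latter contributes a
  nonnegative amount, and all other terms contain \<open>\<sigma>\<close>, whose norm is at most |n
  . \<xi>| + |n . i\<xi>|.\<close>

lemma levi_ge_of_complex_tangent:
  fixes n :: "complex^'n"
  assumes A: "linear A" "\<And>h. norm (A h) \<le> B * norm h" and n: "norm n = 1"
    and tang: "\<And>\<tau>. n \<bullet> \<tau> = 0 \<Longrightarrow> n \<bullet> (\<i> *s \<tau>) = 0 \<Longrightarrow> 0 \<le> levi A \<tau>"
  shows "- (4 * B * norm \<xi> * (\<bar>n \<bullet> \<xi>\<bar> + \<bar>n \<bullet> (\<i> *s \<xi>)\<bar>)) \<le> levi A \<xi>"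
proof -
  \<comment> \<open>The sign in \<open>b\<close> is due to (i n) . \<xi> = - n . (i \<xi>): these
    are the coordinates of \<open>\<xi>\<close> along n and i n.\<close>
  define a b where "a = n \<bullet> \<xi>" and "b = - (n \<bullet> (\<i> *s \<xi>))"
  define \<sigma> where "\<sigma> = a *\<^sub>R n + b *\<^sub>R (\<i> *s n)"
  define \<tau> where "\<tau> = \<xi> - \<sigma>"
  let ?J = "\<lambda>x :: complex^'n. \<i> *s x"
  note J = bounded_linear_vector_scalar_mult_right[of \<i>, THEN bounded_linear.linear]
  have nn: "n \<bullet> n = 1" using n by (simp add: norm_eq_1)
  have J\<sigma>: "?J \<sigma> = a *\<^sub>R ?J n - b *\<^sub>R n"
    unfolding \<sigma>_def linear_add[OF J] linear_cmul[OF J] by simp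
  have "n \<bullet> \<tau> = 0" by (simp add: \<tau>_def \<sigma>_def inner_diff_right inner_add_right nn a_def)
  moreover have "n \<bullet> ?J \<tau> = 0"
    by (simp add: \<tau>_def linear_diff[OF J] J\<sigma> inner_diff_right inner_add_right nn b_def)
  ultimately have \<tau>: "0 \<le> levi A \<tau>" by (rule tang)
  define Q where "Q = \<bar>n \<bullet> \<xi>\<bar> + \<bar>n \<bullet> ?J \<xi>\<bar>"
  have n\<sigma>: "norm \<sigma> \<le> Q"
    unfolding \<sigma>_def Q_def using norm_triangle_ineq[of "a *\<^sub>R n" "b *\<^sub>R ?J n"] n
    by (simp add: a_def b_def)
  have Q: "Q \<le> 2 * norm \<xi>"
    using Cauchy_Schwarz_ineq2[of n \<xi>] Cauchy_Schwarz_ineq2[of n "?J \<xi>"] n by (simp add: Q_def)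
  have n\<tau>: "norm \<tau> \<le> 3 * norm \<xi>"
    using norm_triangle_ineq4[of \<xi> \<sigma>] n\<sigma> Q by (simp add: \<tau>_def)
  have B: "0 \<le> B" using A(2)[of n] n norm_ge_zero[of "A n"] by (simp del: norm_ge_zero)
  \<comment> \<open>The two mixed terms cost 3 each because |x| is at most 3 |\<xi>|, the square of
    y costs 2, together 8. Summing over \<open>\<xi>\<close> and \<open>\<i> *s \<xi>\<close> and
    dividing by 4 gives the constant 4.\<close>
  have low: "A x \<bullet> x - 8 * B * norm \<xi> * Q \<le> A (x + y) \<bullet> (x + y)"
    if x: "norm x \<le> 3 * norm \<xi>" and y: "norm y \<le> Q" for x y
  proof -
    have bil: "- (B * norm s * norm t) \<le> A s \<bullet> t" for s t
      using Cauchy_Schwarz_ineq2[of "A s" t] mult_right_mono[OF A(2)[of s], of "norm t"] by auto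
    have "norm x * norm y \<le> 3 * norm \<xi> * Q" "norm y * norm y \<le> 2 * norm \<xi> * Q"
      using mult_mono[OF x y] mult_mono[OF order_trans[OF y Q] y] by auto
    then have "B * (2 * (norm x * norm y) + norm y * norm y) \<le> B * (8 * norm \<xi> * Q)"
      using B by (intro mult_left_mono) auto
    moreover have "A (x + y) \<bullet> (x + y) = A x \<bullet> x + A x \<bullet> y + A y \<bullet> x + A y \<bullet> y"
      by (simp add: linear_add[OF A(1)] inner_add_left inner_add_right)
    ultimately show ?thesis
      using bil[of x y] bil[of y x] bil[of y y] by (simp add: algebra_simps)
  qed
  have "\<xi> = \<tau> + \<sigma>" by (simp add: \<tau>_def)
  then have "A \<xi> \<bullet> \<xi> \<ge> A \<tau> \<bullet> \<tau> - 8 * B * norm \<xi> * Q"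
    using low[OF n\<tau> n\<sigma>] by simp
  moreover have "?J \<xi> = ?J \<tau> + ?J \<sigma>" using \<open>\<xi> = \<tau> + \<sigma>\<close> linear_add[OF J] by metis
  then have "A (?J \<xi>) \<bullet> ?J \<xi> \<ge> A (?J \<tau>) \<bullet> ?J \<tau> - 8 * B * norm \<xi> * Q"
    using low[of "?J \<tau>" "?J \<sigma>"] n\<tau> n\<sigma> by simp
  ultimately show ?thesis using \<tau> by (simp add: Q_def[symmetric])
qed


text \<open>Only the Hessian on the compact frontier has to be bounded, since every point of the
  collar is compared with its nearest frontier point.\<close>

lemma levi_signed_dist_ge:
  fixes \<Omega> :: "(complex^'n) set"
  assumes dom: "C2_domain \<Omega> U r N D"
    and pc: "\<And>p \<tau>. p \<in> frontier \<Omega> \<Longrightarrow> N p \<bullet> \<tau> = 0 \<Longrightarrow> N p \<bullet> (\<i> *s \<tau>) = 0 \<Longrightarrow> 0 \<le> levi (D p) \<tau>"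
  obtains \<epsilon> g H C where "\<epsilon> > 0" "C2_grad {z. infdist z (frontier \<Omega>) < \<epsilon>} (signed_dist \<Omega>) g H"
    "\<And>p. p \<in> frontier \<Omega> \<Longrightarrow> g p \<noteq> 0"
    "\<And>z \<xi>. z \<in> \<Omega> \<Longrightarrow> infdist z (frontier \<Omega>) < \<epsilon> \<Longrightarrow>
      - (C * norm \<xi> * (\<bar>g z \<bullet> \<xi>\<bar> + \<bar>g z \<bullet> (\<i> *s \<xi>)\<bar>)) \<le> levi (H z) \<xi>"
proof -
  interpret C2_domain \<Omega> U r N D by (rule dom)
  obtain \<epsilon> g H where \<epsilon>: "\<epsilon> > 0"
    and gH: "C2_grad {z. infdist z (frontier \<Omega>) < \<epsilon>} (signed_dist \<Omega>) g H"
    and g\<nu>: "\<And>p. p \<in> frontier \<Omega> \<Longrightarrow> g p = \<nu> p"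
  proof (rule signed_dist_C2, goal_cases)
    case (1 \<epsilon> g H)
    from 1(2-) show ?case by (rule 1(1))
  qed
  define S where "S = {z. infdist z (frontier \<Omega>) < \<epsilon>}"
  note gH = gH[folded S_def]
  have oS: "open S"
    unfolding S_def by (intro open_Collect_less continuous_intros)
  have FS: "frontier \<Omega> \<subseteq> S" using \<epsilon> by (auto simp: S_def)
  have "C1_field S g H" using gH by (simp add: C2_grad_def)
  from C1_field_blinfun[OF this] obtain K where K:
    "\<And>z. z \<in> S \<Longrightarrow> blinfun_apply (K z) = H z" "continuous_on S K" by blast
  have "compact (K ` frontier \<Omega>)"
    by (intro compact_continuous_image continuous_on_subset[OF K(2) FS] compact_frontier_bounded bounded_dom)
  then obtain B where B: "\<And>p. p \<in> frontier \<Omega> \<Longrightarrow> norm (K p) \<le> B"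
    using compact_imp_bounded by (fastforce simp: bounded_iff)
  have HB: "norm (H p h) \<le> B * norm h" if "p \<in> frontier \<Omega>" for p h
  proof -
    have "norm (H p h) \<le> norm (K p) * norm h"
      using norm_blinfun[of "K p" h] K(1)[of p] FS that by auto
    also have "\<dots> \<le> B * norm h" by (intro mult_right_mono B that) simp
    finally show ?thesis .
  qed
  \<comment> \<open>Pseudoconvexity is given for \<open>r\<close> and has to be passed on to the
    signed distance. Both gradients at p are positive multiples of \<open>\<nu> p\<close>, which
    serves as the transversal direction in the sublevel comparison.\<close>
  have bdry: "0 \<le> levi (H p) \<tau>"
    if p: "p \<in> frontier \<Omega>" and \<tau>: "\<nu> p \<bullet> \<tau> = 0" "\<nu> p \<bullet> (\<i> *s \<tau>) = 0" for p \<tau>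
  proof -
    have pU: "p \<in> U" and Np: "N p \<noteq> 0" using p frontier_in_U N_nz by auto
    have N\<tau>: "N p \<bullet> \<tau> = 0" "N p \<bullet> (\<i> *s \<tau>) = 0" using \<tau> Np by (simp_all add: \<nu>_def)
    have cmp: "(D p v \<bullet> v) / norm (N p) \<le> H p v \<bullet> v" if v: "N p \<bullet> v = 0" for v
    proof -
      have "(D p v \<bullet> v) / (N p \<bullet> \<nu> p) \<le> (H p v \<bullet> v) / (g p \<bullet> \<nu> p)"
      proof (rule hessian_compare_sublevel[where V = "S \<inter> U" and f = "signed_dist \<Omega>" and k = r
            and gf = g and gk = N and Hf = H and Hk = D and p = p and v = v and w = "\<nu> p"])
        show "C2_grad (S \<inter> U) (signed_dist \<Omega>) g H" "C2_grad (S \<inter> U) r N D"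
          using C2_grad_subset[OF gH] C2_grad_subset[OF r] by auto
        show "r z < 0" if "z \<in> S \<inter> U" "signed_dist \<Omega> z < 0" for z
          using that dom_eq infdist_nonneg[of z "frontier \<Omega>"]
          by (force simp: signed_dist_def split: if_splits)
        show "0 < N p \<bullet> \<nu> p" "0 < g p \<bullet> \<nu> p"
          using Np norm_\<nu>[OF Np] by (simp_all add: g\<nu>[OF p] norm_eq_1) (simp add: \<nu>_def)
      qed (use oS U FS p pU v in \<open>auto simp: signed_dist_frontier r_frontier g\<nu> \<nu>_def\<close>)
      moreover have "N p \<bullet> \<nu> p = norm (N p)"
        using Np by (simp add: \<nu>_def power2_norm_eq_inner[symmetric] power2_eq_square)
      moreover have "g p \<bullet> \<nu> p = 1"
        using norm_\<nu>[OF Np] by (simp add: g\<nu>[OF p] norm_eq_1)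
      ultimately show ?thesis by simp
    qed
    have "0 \<le> levi (D p) \<tau> / norm (N p)" using pc[OF p N\<tau>] by simp
    also have "\<dots> = ((D p \<tau> \<bullet> \<tau>) / norm (N p) + (D p (\<i> *s \<tau>) \<bullet> (\<i> *s \<tau>)) / norm (N p)) / 4"
      by (simp add: add_divide_distrib)
    also have "\<dots> \<le> levi (H p) \<tau>"
      using cmp[OF N\<tau>(1)] cmp[OF N\<tau>(2)] by (intro divide_right_mono add_mono) auto
    finally show ?thesis .
  qed
  show thesis
  proof (rule that[OF \<epsilon> gH[unfolded S_def], where C = "4 * B"])
    show "g p \<noteq> 0" if "p \<in> frontier \<Omega>" for p
      using g\<nu>[OF that] norm_\<nu>[OF N_nz[OF that]] by auto
    fix z \<xi> assume z: "z \<in> \<Omega>" "infdist z (frontier \<Omega>) < \<epsilon>"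
    obtain p where p: "p \<in> frontier \<Omega>" "dist z p = infdist z (frontier \<Omega>)"
      by (rule nearest_point_exists)
    have zp: "z \<in> S" "p \<in> S" using z(2) p(1) FS by (auto simp: S_def)
    \<comment> \<open>The right hand side equals dist z p, which is also the distance of the
      translated points, so the Lipschitz bound is exactly what is needed.\<close>
    have le: "signed_dist \<Omega> (p + h) - signed_dist \<Omega> (z + h) \<le> signed_dist \<Omega> p - signed_dist \<Omega> z" for h
      using signed_dist_lipschitz[of \<Omega> "p + h" "z + h"] z(1) p(2)
      by (simp add: signed_dist_frontier[OF p(1)] signed_dist_def[of _ z] dist_norm norm_minus_commute)
    note cmp = hessian_compare_translate[OF oS zp(2,1) gH le]
    have "- (4 * B * norm \<xi> * (\<bar>\<nu> p \<bullet> \<xi>\<bar> + \<bar>\<nu> p \<bullet> (\<i> *s \<xi>)\<bar>)) \<le> levi (H p) \<xi>"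
      by (rule levi_ge_of_complex_tangent[OF C2_grad_linear[OF gH zp(2)] HB[OF p(1)]
            norm_\<nu>[OF N_nz[OF p(1)]] bdry[OF p(1)]])
    also have "\<dots> \<le> levi (H z) \<xi>"
      using cmp(2)[of \<xi>] cmp(2)[of "\<i> *s \<xi>"] by simp
    finally show "- (4 * B * norm \<xi> * (\<bar>g z \<bullet> \<xi>\<bar> + \<bar>g z \<bullet> (\<i> *s \<xi>)\<bar>)) \<le> levi (H z) \<xi>"
      by (simp add: cmp(1) g\<nu>[OF p(1)])
  qed
qed

section \<open>Extension of the signed distance to a defining function on the whole domain\<close>

lemma DERIV_max_0_power:
  fixes a s :: real
  assumes n: "2 \<le> n"
  shows "((\<lambda>s. max 0 (s + a) ^ n) has_real_derivative real n * max 0 (s + a) ^ (n - 1)) (at s)"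
proof (cases "s + a = 0")
  case False
  show ?thesis
  proof (cases "s + a > 0")
    case True
    have "((\<lambda>s. (s + a) ^ n) has_real_derivative real n * max 0 (s + a) ^ (n - 1)) (at s)"
      by (rule DERIV_cong[OF DERIV_power[of "\<lambda>s. s + a" 1]])
        (use True in \<open>auto intro!: derivative_eq_intros\<close>)
    then show ?thesis
      by (rule has_field_derivative_transform_within_open[where S = "{- a<..}"]) (use True in auto)
  next
    case lt: False
    have "((\<lambda>s. 0) has_real_derivative real n * max 0 (s + a) ^ (n - 1)) (at s)"
      using lt n by (auto intro!: derivative_eq_intros)
    then show ?thesis
      by (rule has_field_derivative_transform_within_open[where S = "{..<- a}"]) (use lt False n in auto)
  qed
next
  case True
  have "(\<lambda>h. max 0 h ^ n / h) \<midarrow>0\<rightarrow> (0::real)"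
  proof (rule Lim_null_comparison)
    have "norm (max 0 h ^ n / h) \<le> \<bar>h\<bar> ^ (n - 1)" for h :: real
      using n by (cases n) (auto simp: max_def)
    then show "\<forall>\<^sub>F h in at 0. norm (max 0 h ^ n / h) \<le> \<bar>h::real\<bar> ^ (n - 1)"
      by simp
    have "((\<lambda>h. \<bar>h\<bar> ^ (n - 1)) \<longlongrightarrow> \<bar>0::real\<bar> ^ (n - 1)) (at 0)" by (intro tendsto_intros)
    then show "((\<lambda>h. \<bar>h\<bar> ^ (n - 1)) \<longlongrightarrow> (0::real)) (at 0)" using n by (simp add: power_0_left)
  qed
  moreover have "a = - s" using True by simp
  ultimately show ?thesis using n by (simp add: DERIV_def power_0_left)
qed

text \<open>The two-sided control of \<open>\<rho>\<close> serves the logarithm: the lower bound for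
  \<open>- \<rho>\<close> bounds -log(-\<rho>) by |log d| up to a constant, and the upper bound
  keeps -log(-\<rho>) bounded below.\<close>

lemma defining_function_levi_ge:
  fixes \<Omega> :: "(complex^'n) set"
  assumes dom: "C2_domain \<Omega> U r N D"
    and pc: "\<And>p \<tau>. p \<in> frontier \<Omega> \<Longrightarrow> N p \<bullet> \<tau> = 0 \<Longrightarrow> N p \<bullet> (\<i> *s \<tau>) = 0 \<Longrightarrow> 0 \<le> levi (D p) \<tau>"
  obtains \<rho> g H C \<kappa> M where "C2_defining_function \<Omega> \<rho>" "C2_grad \<Omega> \<rho> g H"
    "\<kappa> > 0" "\<And>z. z \<in> \<Omega> \<Longrightarrow> 0 < infdist z (frontier \<Omega>) \<and> \<kappa> * infdist z (frontier \<Omega>) \<le> - \<rho> z \<and> - \<rho> z \<le> M"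
    "\<And>z \<xi>. z \<in> \<Omega> \<Longrightarrow> - (C * norm \<xi> * (\<bar>g z \<bullet> \<xi>\<bar> + \<bar>g z \<bullet> (\<i> *s \<xi>)\<bar>)) \<le> levi (H z) \<xi>"
proof -
  interpret C2_domain \<Omega> U r N D by (rule dom)
  obtain \<epsilon> g H C where \<epsilon>: "\<epsilon> > 0"
    and gH: "C2_grad {z. infdist z (frontier \<Omega>) < \<epsilon>} (signed_dist \<Omega>) g H"
    and g0: "\<And>p. p \<in> frontier \<Omega> \<Longrightarrow> g p \<noteq> 0"
    and low: "\<And>z \<xi>. z \<in> \<Omega> \<Longrightarrow> infdist z (frontier \<Omega>) < \<epsilon> \<Longrightarrow>
      - (C * norm \<xi> * (\<bar>g z \<bullet> \<xi>\<bar> + \<bar>g z \<bullet> (\<i> *s \<xi>)\<bar>)) \<le> levi (H z) \<xi>"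
  proof (rule levi_signed_dist_ge[OF dom], goal_cases)
    case (1 p \<tau>)
    then show ?case by (intro pc)
  next
    case (2 \<epsilon> g H C)
    from 2(2-) show ?case by (rule 2(1))
  qed
  define a where "a = \<epsilon> / 2"
  have a: "0 < a" "a < \<epsilon>" using \<epsilon> by (auto simp: a_def)
  \<comment> \<open>Convex, nondecreasing, zero at 0 and constant for s <= -a, so
    \<open>\<rho>\<close> is constant away from the collar, where smoothness of the distance is
    unknown. The cube makes the junction twice continuously differentiable.\<close>
  define m where "m s = max 0 (s + a) ^ 3 - a ^ 3" for s :: real
  define m' where "m' s = 3 * max 0 (s + a) ^ 2" for s :: real
  define m'' where "m'' s = 6 * max 0 (s + a)" for s :: real
  define S where "S = {z. infdist z (frontier \<Omega>) < \<epsilon>}"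
  define I where "I = {z \<in> \<Omega>. a < infdist z (frontier \<Omega>)}"
  define \<rho> where "\<rho> z = m (signed_dist \<Omega> z)" for z
  define W where "W = \<Omega> \<union> S"
  have dm: "(m has_real_derivative m' s) (at s)" for s
    unfolding m_def m'_def
    by (rule DERIV_cong[OF DERIV_diff[OF DERIV_max_0_power DERIV_const]]) auto
  have dm': "(m' has_real_derivative m'' s) (at s)" for s
    unfolding m'_def m''_def
    by (rule DERIV_cong[OF DERIV_cmult[OF DERIV_max_0_power]]) auto
  have dS: "C2_grad S \<rho> (\<lambda>z. m' (signed_dist \<Omega> z) *\<^sub>R g z)
     (\<lambda>z h. m' (signed_dist \<Omega> z) *\<^sub>R H z h + (m'' (signed_dist \<Omega> z) * (g z \<bullet> h)) *\<^sub>R g z)"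
    unfolding \<rho>_def
    by (rule C2_grad_compose[OF gH[folded S_def] dm dm']) (auto simp: m''_def intro!: continuous_intros)
  have oS: "open S" unfolding S_def by (intro open_Collect_less continuous_intros)
  have "I = \<Omega> \<inter> {z. a < infdist z (frontier \<Omega>)}" by (auto simp: I_def)
  moreover have "open {z. a < infdist z (frontier \<Omega>)}" by (intro open_Collect_less continuous_intros)
  ultimately have oI: "open I" using open_dom by auto
  have \<rho>I: "\<rho> z = - (a ^ 3)" if "z \<in> I" for z
    using that by (simp add: I_def \<rho>_def m_def signed_dist_def)
  have dI: "C2_grad I \<rho> (\<lambda>z. 0) (\<lambda>z h. 0)"
  proof (rule C2_gradI)
    fix z assume z: "z \<in> I"
    have "((\<lambda>_. - (a ^ 3)) has_derivative (\<bullet>) 0) (at z)"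
      by (rule has_derivative_eq_rhs[OF has_derivative_const]) auto
    then show "(\<rho> has_derivative (\<bullet>) 0) (at z)"
      by (rule has_derivative_transform_within_open[OF _ oI z]) (auto simp: \<rho>I)
  qed auto
  have WSI: "W = S \<union> I" using a by (auto simp: W_def S_def I_def)
  have oW: "open W" using oS oI WSI by auto
  have "\<exists>g H. C2_grad W \<rho> g H"
    by (rule C2_grad_local[OF oW]) (use oS oI dS dI WSI in blast)
  then obtain G K where GK: "C2_grad W \<rho> G K" by blast
  have GS: "G z = m' (signed_dist \<Omega> z) *\<^sub>R g z"
    "K z = (\<lambda>h. m' (signed_dist \<Omega> z) *\<^sub>R H z h + (m'' (signed_dist \<Omega> z) * (g z \<bullet> h)) *\<^sub>R g z)"
    if "z \<in> S" for z
    using C2_grad_unique[OF oW oS _ that GK dS] that WSI by auto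
  have GI: "K z = (\<lambda>h. 0)" "G z = 0" if "z \<in> I" for z
    using C2_grad_unique[OF oW oI _ that GK dI] that WSI by auto
  have \<Omega>W: "\<Omega> \<subseteq> W" by (auto simp: W_def)
  have FS: "frontier \<Omega> \<subseteq> S" using \<epsilon> by (auto simp: S_def)
  have dpos: "0 < infdist z (frontier \<Omega>)" if "z \<in> \<Omega>" for z
  proof -
    have "z \<notin> frontier \<Omega>" using that open_dom by (auto simp: frontier_def interior_open)
    then show ?thesis
      using in_closed_iff_infdist_zero[OF frontier_closed frontier_ne] infdist_nonneg
      by (metis less_eq_real_def)
  qed
  obtain R where R: "\<And>z. z \<in> \<Omega> \<Longrightarrow> norm z \<le> R" using bounded_dom by (auto simp: bounded_iff)
  obtain p0 where p0: "p0 \<in> frontier \<Omega>" using frontier_ne by auto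
  define d0 where "d0 = R + norm p0"
  have d0: "infdist z (frontier \<Omega>) \<le> d0" if "z \<in> \<Omega>" for z
    using infdist_le[OF p0, of z] R[OF that] norm_triangle_ineq4[of z p0] by (simp add: dist_norm d0_def)
  have d0pos: "0 < d0" using d0 dpos dom_ne by fastforce
  \<comment> \<open>The first entry serves points with d <= a, where a^3 - (a - d)^3 is at least a^2
    d; the second serves deeper points, where \<rho> = -a^3 and d <= d0.\<close>
  define \<kappa> where "\<kappa> = min (a\<^sup>2) (a ^ 3 / d0)"
  have \<kappa>: "0 < \<kappa>" using a d0pos by (simp add: \<kappa>_def)
  have \<rho>: "\<kappa> * infdist z (frontier \<Omega>) \<le> - \<rho> z \<and> - \<rho> z \<le> a ^ 3" if z: "z \<in> \<Omega>" for z
  proof (cases "a < infdist z (frontier \<Omega>)")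
    case True
    have "\<kappa> * infdist z (frontier \<Omega>) \<le> (a ^ 3 / d0) * d0"
      using d0[OF z] \<kappa> a d0pos dpos[OF z] by (intro mult_mono) (auto simp: \<kappa>_def)
    then show ?thesis using True z d0pos \<rho>I[of z] by (simp add: I_def)
  next
    case False
    define d where "d = infdist z (frontier \<Omega>)"
    have d: "0 < d" "d \<le> a" using dpos[OF z] False by (auto simp: d_def)
    have e: "- \<rho> z = a ^ 3 - (a - d) ^ 3" using z d by (simp add: \<rho>_def m_def signed_dist_def d_def[symmetric])
    also have "\<dots> = d * a\<^sup>2 + d * (a * (a - d) + (a - d)\<^sup>2)" by (simp add: power2_eq_square power3_eq_cube algebra_simps)
    finally have "d * a\<^sup>2 \<le> - \<rho> z" using d a by simp
    moreover have "\<kappa> * d \<le> d * a\<^sup>2" using d by (simp add: \<kappa>_def mult.commute mult_left_mono)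
    moreover have "0 \<le> (a - d) ^ 3" using d by simp
    ultimately show ?thesis using e by (simp add: d_def)
  qed
  show thesis
  proof (rule that[of \<rho> G K \<kappa> "a ^ 3" C])
    show "C2_defining_function \<Omega> \<rho>"
      unfolding C2_defining_function_def
    proof (intro conjI exI[of _ W] ballI)
      show "closure \<Omega> \<subseteq> W" using FS by (auto simp: W_def closure_Un_frontier)
      show "C2_on W \<rho>" using GK C2_on_iff_grad by blast
      have "\<rho> z < 0" if "z \<in> \<Omega>" for z
        using \<rho>[OF that] mult_pos_pos[OF \<kappa> dpos[OF that]] by linarith
      moreover have "0 \<le> \<rho> z" if "z \<notin> \<Omega>" for z
        using that a infdist_nonneg[of z "frontier \<Omega>"]
        by (simp add: \<rho>_def m_def signed_dist_def power_mono)
      ultimately show "\<Omega> = {z \<in> W. \<rho> z < 0}" using \<Omega>W by force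
      fix p assume p: "p \<in> frontier \<Omega>"
      have "p \<in> W" using p FS by (auto simp: W_def)
      from frechet_derivative_at[OF C2_gradD(1)[OF GK this]]
      have fd: "frechet_derivative \<rho> (at p) = (\<lambda>h. G p \<bullet> h)" by simp
      have "G p \<noteq> 0" using GS(1)[of p] FS p g0[OF p] a by (auto simp: signed_dist_frontier m'_def)
      then show "frechet_derivative \<rho> (at p) \<noteq> (\<lambda>v. 0)"
        unfolding fd by (metis inner_eq_zero_iff)
    qed (rule oW)
    show "C2_grad \<Omega> \<rho> G K" by (rule C2_grad_subset[OF GK \<Omega>W])
    show "0 < infdist z (frontier \<Omega>) \<and> \<kappa> * infdist z (frontier \<Omega>) \<le> - \<rho> z \<and> - \<rho> z \<le> a ^ 3"
      if "z \<in> \<Omega>" for z using \<rho>[OF that] dpos[OF that] by blast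
    fix z \<xi> assume z: "z \<in> \<Omega>"
    show "- (C * norm \<xi> * (\<bar>G z \<bullet> \<xi>\<bar> + \<bar>G z \<bullet> (\<i> *s \<xi>)\<bar>)) \<le> levi (K z) \<xi>"
    proof (cases "z \<in> I")
      case True
      then show ?thesis by (simp add: GI)
    next
      case False
      then have zS: "z \<in> S" using z \<Omega>W WSI by blast
      define s where "s = signed_dist \<Omega> z"
      have m: "0 \<le> m' s" "0 \<le> m'' s" by (auto simp: m'_def m''_def)
      have "levi (K z) \<xi> = m' s * levi (H z) \<xi> + m'' s * ((g z \<bullet> \<xi>)\<^sup>2 + (g z \<bullet> (\<i> *s \<xi>))\<^sup>2) / 4"
        by (simp add: GS(2)[OF zS] s_def[symmetric] inner_add_left power2_eq_square algebra_simps add_divide_distrib)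
      \<comment> \<open>Convexity of \<open>m\<close> makes the rank one term nonnegative. The
        gradient of \<open>\<rho>\<close> is \<open>m' s *\<^sub>R g z\<close>, so both sides of the
        estimate scale by \<open>m' s\<close> and the constant \<open>C\<close> survives.\<close>
      also have "\<dots> \<ge> m' s * levi (H z) \<xi>" using m by simp
      also have "m' s * levi (H z) \<xi> \<ge> m' s * - (C * norm \<xi> * (\<bar>g z \<bullet> \<xi>\<bar> + \<bar>g z \<bullet> (\<i> *s \<xi>)\<bar>))"
        using m low[OF z, of \<xi>] zS by (intro mult_left_mono) (auto simp: S_def)
      finally show ?thesis
        using m by (simp add: GS(1)[OF zS] s_def[symmetric] abs_mult algebra_simps)
    qed
  qed (rule \<kappa>)
qed

subsection \<open>The bounded plurisubharmonic function\<close>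

lemma form_val_scaleR: "form_val (c *\<^sub>R A) \<xi> = c * form_val A \<xi>"
  by (simp add: form_val_def scaleR_sum_right[symmetric])

text \<open>Complex tangency, a single complex equation in \<open>pseudoconvex\<close>, thereby
  becomes the pair of real orthogonality conditions for \<open>\<xi>\<close> and
  \<open>\<i> *s \<xi>\<close>.\<close>

lemma sum_dz:
  fixes u :: "complex^'n \<Rightarrow> real"
  assumes "(u has_derivative (\<lambda>h. g \<bullet> h)) (at z)"
  shows "(\<Sum>j\<in>UNIV. dz j (\<lambda>w. complex_of_real (u w)) z * \<xi> $ j)
    = (of_real (g \<bullet> \<xi>) - \<i> * of_real (g \<bullet> (\<i> *s \<xi>))) / 2"
proof -
  have "((\<lambda>w. complex_of_real (u w)) has_derivative (\<lambda>h. of_real (g \<bullet> h))) (at z)"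
    by (rule bounded_linear.has_derivative[OF bounded_linear_of_real assms])
  from frechet_derivative_at[OF this, symmetric]
  have "dz j (\<lambda>w. complex_of_real (u w)) z * \<xi> $ j =
      (of_real (g \<bullet> (Re (\<xi> $ j) *\<^sub>R axis j 1 + Im (\<xi> $ j) *\<^sub>R axis j \<i>))
      - \<i> * of_real (g \<bullet> (Re ((\<i> *s \<xi>) $ j) *\<^sub>R axis j 1 + Im ((\<i> *s \<xi>) $ j) *\<^sub>R axis j \<i>))) / 2" for j
    by (simp add: dz_def inner_add_right complex_eq_iff algebra_simps)
  then have "(\<Sum>j\<in>UNIV. dz j (\<lambda>w. complex_of_real (u w)) z * \<xi> $ j) =
      (of_real (g \<bullet> (\<Sum>j\<in>UNIV. Re (\<xi> $ j) *\<^sub>R axis j 1 + Im (\<xi> $ j) *\<^sub>R axis j \<i>))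
      - \<i> * of_real (g \<bullet> (\<Sum>j\<in>UNIV. Re ((\<i> *s \<xi>) $ j) *\<^sub>R axis j 1 + Im ((\<i> *s \<xi>) $ j) *\<^sub>R axis j \<i>))) / 2"
    by (simp only: inner_sum_right of_real_sum sum_distrib_left sum_subtractf[symmetric] sum_divide_distrib[symmetric])
  then show ?thesis
    by (simp only: complex_vec_expansion[symmetric])
qed

lemma pseudoconvex_C2_domain:
  fixes \<Omega> :: "(complex^'n) set"
  assumes "bounded_domain \<Omega>" "pseudoconvex \<Omega>"
  obtains U r N D where "C2_domain \<Omega> U r N D"
    "\<And>p \<tau>. p \<in> frontier \<Omega> \<Longrightarrow> N p \<bullet> \<tau> = 0 \<Longrightarrow> N p \<bullet> (\<i> *s \<tau>) = 0 \<Longrightarrow> 0 \<le> levi (D p) \<tau>"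
proof -
  from assms(2) obtain r where r: "C2_defining_function \<Omega> r"
    and pc: "\<And>p \<xi>. p \<in> frontier \<Omega> \<Longrightarrow>
      (\<Sum>j\<in>UNIV. dz j (\<lambda>w. complex_of_real (r w)) p * \<xi> $ j) = 0 \<Longrightarrow> 0 \<le> form_val (ddbar r p) \<xi>"
    unfolding pseudoconvex_def by blast
  from r obtain U where U: "open U" "closure \<Omega> \<subseteq> U" "C2_on U r" "\<Omega> = {z\<in>U. r z < 0}"
    and fd: "\<And>p. p \<in> frontier \<Omega> \<Longrightarrow> frechet_derivative r (at p) \<noteq> (\<lambda>v. 0)"
    unfolding C2_defining_function_def by blast
  from U(3) obtain N D where ND: "C2_grad U r N D" using C2_on_iff_grad by blast
  have FU: "p \<in> U" if "p \<in> frontier \<Omega>" for p using that U(2) by (auto simp: frontier_def)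
  have N: "N p \<noteq> 0" if p: "p \<in> frontier \<Omega>" for p
  proof
    assume "N p = 0"
    with frechet_derivative_at[OF C2_gradD(1)[OF ND FU[OF p]]] fd[OF p] show False by simp
  qed
  show thesis
  proof (rule that)
    show "C2_domain \<Omega> U r N D"
      using assms(1) U ND N by unfold_locales (auto simp: bounded_domain_def)
    fix p \<tau> assume p: "p \<in> frontier \<Omega>" and \<tau>: "N p \<bullet> \<tau> = 0" "N p \<bullet> (\<i> *s \<tau>) = 0"
    from pc[OF p, of \<tau>] show "0 \<le> levi (D p) \<tau>"
      by (simp add: sum_dz[OF C2_gradD(1)[OF ND FU[OF p]]] \<tau> form_val_ddbar[OF U(1) FU[OF p] ND])
  qed
qed

section \<open>Building blocks of the bounded function and the balance of its terms\<close>

lemma C2_grad_add: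
  assumes "C2_grad V u g H" "C2_grad V u' g' H'"
  shows "C2_grad V (\<lambda>z. u z + u' z) (\<lambda>z. g z + g' z) (\<lambda>z h. H z h + H' z h)"
  using assms
  by (auto simp: C2_grad_def C1_field_def inner_add_left intro!: derivative_eq_intros continuous_intros)

lemma C2_grad_cmult:
  assumes "C2_grad V u g H"
  shows "C2_grad V (\<lambda>z. c * u z) (\<lambda>z. c *\<^sub>R g z) (\<lambda>z h. c *\<^sub>R H z h)"
  using assms
  by (auto simp: C2_grad_def C1_field_def intro!: derivative_eq_intros continuous_intros)

lemma C2_grad_norm_sq: "C2_grad V (\<lambda>z. (norm z)\<^sup>2) (\<lambda>z. 2 *\<^sub>R z) (\<lambda>z h. 2 *\<^sub>R h)"
  unfolding power2_norm_eq_inner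
  by (rule C2_gradI) (auto intro!: derivative_eq_intros simp: inner_commute)

text \<open>With t = A - ln(-s) one has dt/ds = -1/s. For \<beta> = \<alpha> - 1 both derivatives
  carry t^(-\<alpha>), the weight that the balance of terms requires.\<close>

lemma DERIV_neg_powr_log:
  fixes A \<beta> s :: real
  assumes "s < 0" "0 < A - ln (- s)"
  shows "((\<lambda>s. - ((A - ln (- s)) powr - \<beta>)) has_real_derivative
      \<beta> * (A - ln (- s)) powr (- \<beta> - 1) / - s) (at s)"
    and "((\<lambda>s. \<beta> * (A - ln (- s)) powr (- \<beta> - 1) / - s) has_real_derivative
      \<beta> * (A - ln (- s)) powr (- \<beta> - 1) * (1 - (\<beta> + 1) / (A - ln (- s))) / s\<^sup>2) (at s)"
proof -
  define t where "t s = A - ln (- s)" for s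
  have dt: "(t has_real_derivative - 1 / s) (at s)"
    unfolding t_def using assms(1) by (auto intro!: derivative_eq_intros simp: field_simps)
  have t: "0 < t s" using assms(2) by (simp add: t_def)
  have p: "((\<lambda>s. t s powr b) has_real_derivative b * t s powr (b - 1) * (- 1 / s)) (at s)" for b
    by (rule DERIV_chain2[OF has_real_derivative_powr[OF t] dt])
  have "((\<lambda>s. - (t s powr - \<beta>)) has_real_derivative \<beta> * t s powr (- \<beta> - 1) / - s) (at s)"
    by (rule DERIV_cong[OF DERIV_minus[OF p]]) (use assms(1) in \<open>simp add: field_simps\<close>)
  then show "((\<lambda>s. - ((A - ln (- s)) powr - \<beta>)) has_real_derivative
      \<beta> * (A - ln (- s)) powr (- \<beta> - 1) / - s) (at s)" by (simp add: t_def)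
  have e: "t s powr (- \<beta> - 1 - 1) = t s powr (- \<beta> - 1) / t s"
    using t by (subst powr_diff) simp
  have "((\<lambda>s. \<beta> * t s powr (- \<beta> - 1) / - s) has_real_derivative
      (\<beta> * ((- \<beta> - 1) * (t s powr (- \<beta> - 1) / t s) * (- 1 / s)) * - s - \<beta> * t s powr (- \<beta> - 1) * - 1) / (- s * - s)) (at s)"
    by (rule DERIV_divide[OF DERIV_cmult[OF p[of "- \<beta> - 1", unfolded e]] DERIV_minus[OF DERIV_ident]])
      (use assms(1) in simp)
  then show "((\<lambda>s. \<beta> * (A - ln (- s)) powr (- \<beta> - 1) / - s) has_real_derivative
      \<beta> * (A - ln (- s)) powr (- \<beta> - 1) * (1 - (\<beta> + 1) / (A - ln (- s))) / s\<^sup>2) (at s)"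
    unfolding t_def[symmetric]
    by (rule DERIV_cong) (use assms(1) t in \<open>simp add: field_simps power2_eq_square\<close>)
qed

text \<open>Here x = |\<xi>|, R = -\<rho>, s = t^\<alpha>, L is the Levi form of \<rho>, and a, b
  are its gradient tested on \<xi> and i\<xi>. The first term is supplied by \<lambda> and |z|^2,
  the next two by the logarithmic function, and the last one is to be controlled. The two multiples
  of L / R add up to at most 3, which leaves the error 3 C x y.\<close>

lemma levi_balance:
  fixes C x a b s R L k \<theta> :: real
  assumes "1 \<le> s" "0 < R" "0 \<le> C" "0 \<le> x" "0 \<le> \<theta>" "\<theta> \<le> 1" "1 / 2 \<le> k"
    and L: "- (C * x * (\<bar>a\<bar> + \<bar>b\<bar>)) \<le> L"
  shows "0 \<le> 18 * C\<^sup>2 * s * x\<^sup>2 + 2 / (s * R) * L + 2 * k / (s * R\<^sup>2) * ((a\<^sup>2 + b\<^sup>2) / 4) + \<theta> * L / R"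
proof -
  define y where "y = (\<bar>a\<bar> + \<bar>b\<bar>) / R"
  have y: "0 \<le> y" using assms by (simp add: y_def)
  have "0 \<le> 2 / s" "2 / s \<le> 2" using assms(1) by (auto simp: field_simps)
  then have w: "0 \<le> 2 / s + \<theta>" "2 / s + \<theta> \<le> 3" using assms by linarith+
  have "- (C * x * y) \<le> L / R"
    using divide_right_mono[OF L, of R] assms(2) by (simp add: y_def)
  then have "(2 / s + \<theta>) * - (C * x * y) \<le> (2 / s + \<theta>) * (L / R)"
    using w by (intro mult_left_mono) auto
  moreover have "(2 / s + \<theta>) * (C * x * y) \<le> 3 * (C * x * y)"
    using w y assms by (intro mult_right_mono) auto
  moreover have "(2 / s + \<theta>) * (L / R) = 2 / (s * R) * L + \<theta> * L / R"
    by (simp add: distrib_right add_divide_distrib)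
  ultimately have 1: "- (3 * C * x * y) \<le> 2 / (s * R) * L + \<theta> * L / R"
    by (simp add: mult.assoc)
  have "(\<bar>a\<bar> + \<bar>b\<bar>)\<^sup>2 \<le> 2 * (a\<^sup>2 + b\<^sup>2)"
    using sum_squares_bound[of "\<bar>a\<bar>" "\<bar>b\<bar>"] by (simp add: power2_sum)
  then have "y\<^sup>2 / (8 * s) \<le> (a\<^sup>2 + b\<^sup>2) / 4 / (s * R\<^sup>2)"
    using assms(1,2) by (simp add: y_def power_divide field_simps)
  also have "\<dots> = 1 / (s * R\<^sup>2) * ((a\<^sup>2 + b\<^sup>2) / 4)" by simp
  also have "\<dots> \<le> 2 * k / (s * R\<^sup>2) * ((a\<^sup>2 + b\<^sup>2) / 4)"
    using assms by (intro mult_right_mono divide_right_mono) auto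
  finally have 2: "y\<^sup>2 / (8 * s) \<le> 2 * k / (s * R\<^sup>2) * ((a\<^sup>2 + b\<^sup>2) / 4)" .
  \<comment> \<open>Completing the square for 3 C x y against y^2 / (8 s) produces the constant
    18.\<close>
  have "0 \<le> (12 * C * s * x - y)\<^sup>2 / (8 * s)" using assms by simp
  also have "\<dots> = 18 * C\<^sup>2 * s * x\<^sup>2 - 3 * C * x * y + y\<^sup>2 / (8 * s)"
    using assms(1) by (simp add: power2_eq_square field_simps)
  finally show ?thesis using 1 2 by linarith
qed

lemma powr_add_le:
  fixes a b \<alpha> :: real
  assumes "0 \<le> a" "0 \<le> b" "0 \<le> \<alpha>"
  shows "(a + b) powr \<alpha> \<le> 2 powr \<alpha> * (a powr \<alpha> + b powr \<alpha>)"
proof -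
  have "(a + b) powr \<alpha> \<le> (2 * max a b) powr \<alpha>"
    using assms by (intro powr_mono2) auto
  also have "\<dots> = 2 powr \<alpha> * max a b powr \<alpha>"
    using assms by (simp add: powr_mult)
  also have "\<dots> \<le> 2 powr \<alpha> * (a powr \<alpha> + b powr \<alpha>)"
    by (intro mult_left_mono) (auto simp: max_def)
  finally show ?thesis .
qed

theorem proposition2p3:
  fixes \<Omega> :: "(complex^'n) set"
    and lam :: "complex^'n \<Rightarrow> real"
    and \<alpha> c :: real
  assumes "bounded_domain \<Omega>" and "C2_boundary \<Omega>" and "pseudoconvex \<Omega>"
    and "C2_on \<Omega> lam" and "psh_on \<Omega> lam"
    and "\<forall>z\<in>\<Omega>. 0 \<le> lam z \<and> lam z \<le> 1"
    and "\<alpha> > 1" and "c > 0"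
    and "\<forall>z\<in>\<Omega>. form_le
           ((c * \<bar>ln (infdist z (frontier \<Omega>))\<bar> powr \<alpha>) *\<^sub>R ddbar (\<lambda>w. (norm w)\<^sup>2) z)
           (ddbar lam z)"
  shows "delta_regular \<Omega>"
proof -
  let ?d = "\<lambda>z. infdist z (frontier \<Omega>)"
  have op: "open \<Omega>" and bdd: "bounded \<Omega>" using assms(1) by (auto simp: bounded_domain_def)
  obtain \<rho> g H C0 \<kappa> B where def: "C2_defining_function \<Omega> \<rho>" and \<rho>: "C2_grad \<Omega> \<rho> g H"
    and \<kappa>: "\<kappa> > 0"
    and size: "\<And>z. z \<in> \<Omega> \<Longrightarrow> 0 < ?d z \<and> \<kappa> * ?d z \<le> - \<rho> z \<and> - \<rho> z \<le> B"
    and low0: "\<And>z \<xi>. z \<in> \<Omega> \<Longrightarrow> - (C0 * norm \<xi> * (\<bar>g z \<bullet> \<xi>\<bar> + \<bar>g z \<bullet> (\<i> *s \<xi>)\<bar>)) \<le> levi (H z) \<xi>"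
  proof (rule pseudoconvex_C2_domain[OF assms(1,3)], goal_cases)
    case (1 U r N D)
    show ?case
    proof (rule defining_function_levi_ge[OF 1(2)], goal_cases)
      case (1 p \<tau>)
      then show ?case by (intro \<open>\<And>p \<tau>. p \<in> frontier \<Omega> \<Longrightarrow> N p \<bullet> \<tau> = 0 \<Longrightarrow> N p \<bullet> (\<i> *s \<tau>) = 0 \<Longrightarrow> 0 \<le> levi (D p) \<tau>\<close>)
    next
      case (2 \<rho> g H C \<kappa> M)
      from 2(1-) show ?case by (rule 1(1))
    qed
  qed
  define C where "C = \<bar>C0\<bar>"
  have low: "- (C * norm \<xi> * (\<bar>g z \<bullet> \<xi>\<bar> + \<bar>g z \<bullet> (\<i> *s \<xi>)\<bar>)) \<le> levi (H z) \<xi>" if "z \<in> \<Omega>" for z \<xi>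
  proof -
    have "C0 * (norm \<xi> * (\<bar>g z \<bullet> \<xi>\<bar> + \<bar>g z \<bullet> (\<i> *s \<xi>)\<bar>)) \<le> C * (norm \<xi> * (\<bar>g z \<bullet> \<xi>\<bar> + \<bar>g z \<bullet> (\<i> *s \<xi>)\<bar>))"
      by (intro mult_right_mono) (auto simp: C_def)
    then show ?thesis using low0[OF that, of \<xi>] unfolding mult.assoc by linarith
  qed
  have neg: "\<rho> z < 0" if "z \<in> \<Omega>" for z
    using size[OF that] mult_pos_pos[OF \<kappa>] by force
  define \<beta> where "\<beta> = \<alpha> - 1"
  have \<beta>: "0 < \<beta>" using assms(7) by (simp add: \<beta>_def)
  \<comment> \<open>Since -\<rho> <= B, this shift gives t >= 2 \<alpha>, hence 1 - \<alpha> / t >=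
    1/2 in the second derivative.\<close>
  define A where "A = ln B + 2 * \<alpha>"
  define t where "t z = A - ln (- \<rho> z)" for z
  have t: "2 * \<alpha> \<le> t z" if "z \<in> \<Omega>" for z
    using size[OF that] neg[OF that] by (simp add: t_def A_def)
  have t1: "1 \<le> t z" if "z \<in> \<Omega>" for z using t[OF that] assms(7) by simp
  define \<phi> where "\<phi> s = - ((A - ln (- s)) powr - \<beta>)" for s
  define \<phi>' where "\<phi>' s = \<beta> * (A - ln (- s)) powr (- \<beta> - 1) / - s" for s
  define \<phi>'' where "\<phi>'' s = \<beta> * (A - ln (- s)) powr (- \<beta> - 1) * (1 - (\<beta> + 1) / (A - ln (- s))) / s\<^sup>2" for s
  have d\<phi>: "(\<phi> has_real_derivative \<phi>' (\<rho> z)) (at (\<rho> z))" "(\<phi>' has_real_derivative \<phi>'' (\<rho> z)) (at (\<rho> z))"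
    if "z \<in> \<Omega>" for z
    using DERIV_neg_powr_log[of "\<rho> z" A \<beta>] neg[OF that] t1[OF that]
    unfolding \<phi>_def[abs_def] \<phi>'_def[abs_def] \<phi>''_def[abs_def] t_def by auto
  have cont: "continuous_on (\<rho> ` \<Omega>) \<phi>''"
    unfolding \<phi>''_def
    by (intro continuous_intros) (use neg t1 in \<open>fastforce simp: t_def\<close>)+
  note d\<rho> = C2_grad_compose[OF \<rho> d\<phi> cont]
  from assms(4) obtain gl Hl where lam: "C2_grad \<Omega> lam gl Hl" using C2_on_iff_grad by blast
  \<comment> \<open>From \<kappa> d <= -\<rho> follows t <= b + |ln d|, and then t^\<alpha> <=
    2^\<alpha> (b^\<alpha> + |ln d|^\<alpha>). \<open>M\<close> times the hypothesis on \<lambda>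
    pays for the logarithmic part of 18 C^2 t^\<alpha>, and \<open>K\<close> pays for the constant
    part.\<close>
  define b where "b = \<bar>A - ln \<kappa>\<bar>"
  define E where "E = 18 * C\<^sup>2 * 2 powr \<alpha>"
  define M where "M = E / c"
  define K where "K = E * b powr \<alpha>"
  have E: "0 \<le> E" "0 \<le> M" "0 \<le> K" using assms(8) by (auto simp: E_def M_def K_def)
  \<comment> \<open>The factor 2 / \<beta> cancels the \<beta> in the derivatives of
    \<open>\<phi>\<close>, and its 2 makes up for the 1/2 in the lower bound for 1 - \<alpha> /
    t.\<close>
  define v where "v z = M * lam z + (K * (norm z)\<^sup>2 + 2 / \<beta> * \<phi> (\<rho> z))" for z
  define Hv where "Hv z h = M *\<^sub>R Hl z h + (K *\<^sub>R 2 *\<^sub>R h +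
      (2 / \<beta>) *\<^sub>R (\<phi>' (\<rho> z) *\<^sub>R H z h + (\<phi>'' (\<rho> z) * (g z \<bullet> h)) *\<^sub>R g z))" for z h
  obtain gv where v: "C2_grad \<Omega> v gv Hv"
    using C2_grad_add[OF C2_grad_cmult[OF lam, of M] C2_grad_add[OF C2_grad_cmult[OF C2_grad_norm_sq, of _ K] C2_grad_cmult[OF d\<rho>, of "2 / \<beta>"]]]
    unfolding v_def[abs_def] Hv_def[abs_def] by blast
  \<comment> \<open>The parameter covers both uses: \<theta> = 0 is plurisubharmonicity of
    \<open>v\<close>, \<theta> = 1 the inequality of delta-regularity.\<close>
  have main: "0 \<le> levi (Hv z) \<xi> + \<theta> * levi (H z) \<xi> / - \<rho> z" if z: "z \<in> \<Omega>" and \<theta>: "0 \<le> \<theta>" "\<theta> \<le> 1" for z \<xi> \<theta>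
  proof -
    define s where "s = t z powr \<alpha>"
    define k where "k = 1 - \<alpha> / t z"
    have s: "1 \<le> s" using t1[OF z] assms(7) by (simp add: s_def ge_one_powr_ge_zero)
    have k: "1 / 2 \<le> k" using t[OF z] t1[OF z] by (simp add: k_def field_simps)
    have powr: "t z powr (- \<beta> - 1) = 1 / s"
      by (simp add: s_def \<beta>_def powr_minus_divide)
    have \<phi>1: "2 / \<beta> * \<phi>' (\<rho> z) = 2 / (s * - \<rho> z)"
      using \<beta> by (simp add: \<phi>'_def t_def[symmetric] powr)
    have \<beta>1: "\<beta> + 1 = \<alpha>" by (simp add: \<beta>_def)
    have \<phi>2: "2 / \<beta> * \<phi>'' (\<rho> z) = 2 * k / (s * (- \<rho> z)\<^sup>2)"
      using \<beta> unfolding \<phi>''_def t_def[symmetric] powr \<beta>1 k_def[symmetric] by simp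
    have "t z \<le> b + \<bar>ln (?d z)\<bar>"
    proof -
      have "ln (\<kappa> * ?d z) \<le> ln (- \<rho> z)"
        using size[OF z] \<kappa> neg[OF z] by (subst ln_le_cancel_iff) auto
      then have "ln \<kappa> + ln (?d z) \<le> ln (- \<rho> z)"
        using size[OF z] \<kappa> by (simp add: ln_mult)
      then show ?thesis by (simp add: t_def b_def)
    qed
    then have "s \<le> (b + \<bar>ln (?d z)\<bar>) powr \<alpha>"
      unfolding s_def using t1[OF z] assms(7) by (intro powr_mono2) auto
    also have "\<dots> \<le> 2 powr \<alpha> * (b powr \<alpha> + \<bar>ln (?d z)\<bar> powr \<alpha>)"
      using assms(7) by (intro powr_add_le) (auto simp: b_def)
    finally have "18 * C\<^sup>2 * s \<le> 18 * C\<^sup>2 * (2 powr \<alpha> * (b powr \<alpha> + \<bar>ln (?d z)\<bar> powr \<alpha>))"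
      by (intro mult_left_mono) auto
    also have "\<dots> = M * (c * \<bar>ln (?d z)\<bar> powr \<alpha>) + K"
      using assms(8) by (simp add: M_def K_def E_def field_simps)
    finally have s_le: "18 * C\<^sup>2 * s \<le> M * (c * \<bar>ln (?d z)\<bar> powr \<alpha>) + K" .
    have "(c * \<bar>ln (?d z)\<bar> powr \<alpha>) * (norm \<xi>)\<^sup>2 \<le> levi (Hl z) \<xi>"
    proof -
      have "form_val (ddbar (\<lambda>w. (norm w)\<^sup>2) z) \<xi> = (norm \<xi>)\<^sup>2"
        using form_val_ddbar[OF op z C2_grad_norm_sq, of \<xi>] by (simp add: power2_norm_eq_inner)
      then show ?thesis
        using bspec[OF assms(9) z] unfolding form_le_def form_val_scaleR form_val_ddbar[OF op z lam]
        by metis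
    qed
    then have "M * ((c * \<bar>ln (?d z)\<bar> powr \<alpha>) * (norm \<xi>)\<^sup>2) \<le> M * levi (Hl z) \<xi>"
      using E by (intro mult_left_mono)
    moreover have "18 * C\<^sup>2 * s * (norm \<xi>)\<^sup>2 \<le> (M * (c * \<bar>ln (?d z)\<bar> powr \<alpha>) + K) * (norm \<xi>)\<^sup>2"
      by (intro mult_right_mono s_le) simp
    ultimately have 1: "18 * C\<^sup>2 * s * (norm \<xi>)\<^sup>2 \<le> M * levi (Hl z) \<xi> + K * (norm \<xi>)\<^sup>2"
      unfolding distrib_right mult.assoc by linarith
    have "levi (Hv z) \<xi> = M * levi (Hl z) \<xi> + K * (norm \<xi>)\<^sup>2
        + (2 / \<beta> * \<phi>' (\<rho> z)) * levi (H z) \<xi>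
        + (2 / \<beta> * \<phi>'' (\<rho> z)) * (((g z \<bullet> \<xi>)\<^sup>2 + (g z \<bullet> (\<i> *s \<xi>))\<^sup>2) / 4)"
      by (simp add: Hv_def inner_add_left dot_square_norm power2_eq_square algebra_simps add_divide_distrib)
    moreover have "0 \<le> 18 * C\<^sup>2 * s * (norm \<xi>)\<^sup>2 + 2 / (s * - \<rho> z) * levi (H z) \<xi>
        + 2 * k / (s * (- \<rho> z)\<^sup>2) * (((g z \<bullet> \<xi>)\<^sup>2 + (g z \<bullet> (\<i> *s \<xi>))\<^sup>2) / 4) + \<theta> * levi (H z) \<xi> / - \<rho> z"
      by (rule levi_balance[OF s _ _ _ \<theta> k low[OF z]]) (use neg[OF z] in \<open>auto simp: C_def\<close>)
    ultimately show ?thesis using 1 unfolding \<phi>1 \<phi>2 by linarith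
  qed
  have "bounded (v ` \<Omega>)"
  proof -
    obtain R where R: "\<And>z. z \<in> \<Omega> \<Longrightarrow> norm z \<le> R" using bdd by (auto simp: bounded_iff)
    have "norm (v z) \<le> M + (K * R\<^sup>2 + 2 / \<beta>)" if z: "z \<in> \<Omega>" for z
    proof -
      have "\<bar>M * lam z\<bar> \<le> M" using assms(6) z E by (simp add: abs_mult mult_left_le)
      moreover have "\<bar>K * (norm z)\<^sup>2\<bar> \<le> K * R\<^sup>2"
        using E R[OF z] by (auto simp: abs_mult intro!: mult_left_mono power_mono)
      moreover have "t z powr - \<beta> \<le> t z powr 0"
        using t1[OF z] \<beta> by (intro powr_mono) auto
      then have "\<bar>\<phi> (\<rho> z)\<bar> \<le> 1" using t1[OF z] by (simp add: \<phi>_def t_def)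
      then have "\<bar>2 / \<beta> * \<phi> (\<rho> z)\<bar> \<le> 2 / \<beta>" using \<beta> by (simp add: abs_mult divide_right_mono)
      ultimately show ?thesis unfolding v_def real_norm_def by linarith
    qed
    then show ?thesis by (auto simp: bounded_iff)
  qed
  moreover have "psh_on \<Omega> v"
    using main[where \<theta> = 0] by (intro psh_on_of_levi[OF v]) simp
  moreover have "form_le (inverse (\<rho> z) *\<^sub>R ddbar \<rho> z) (ddbar v z)" if z: "z \<in> \<Omega>" for z
    unfolding form_le_def form_val_scaleR form_val_ddbar[OF op z v] form_val_ddbar[OF op z \<rho>]
  proof
    fix \<xi>
    have "0 \<le> levi (Hv z) \<xi> + 1 * levi (H z) \<xi> / - \<rho> z" by (rule main[OF z]) auto
    moreover have *: "1 * x / - r = - (inverse r * x)" for x r :: real by (simp add: divide_inverse)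
    ultimately show "inverse (\<rho> z) * levi (H z) \<xi> \<le> levi (Hv z) \<xi>" unfolding * by linarith
  qed
  moreover have "C2_on \<Omega> v" unfolding C2_on_iff_grad by (intro exI[of _ gv] exI[of _ Hv] v)
  ultimately show ?thesis
    using assms(1) def unfolding delta_regular_def
    by (intro conjI exI[of _ v] exI[of _ \<rho>] ballI)
qed

end
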